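(* For all integers $d\geq 1$ and $q\geq 2$, every ordered $d$-degenerate triangle-free graph $H^<$ on $n$ vertices with at least one edge and with interval chromatic number $\chi$ satisfies \[ r_<(H^<;q)\leq n^{21q^2d\lceil\log\chi\rceil^{q-1}}. \]
   Context: Logarithms are to base two. An ordered graph $G^<$ is a finite graph together with a linear order on its vertex set. An ordered copy of $H^<$ in $G^<$ is given by an increasing injection $f\colon V(H)\to V(G)$ with $f(u)f(v)\in E(G)$ whenever $uv\in E(H)$. The interval chromatic number of $G^<$ is the minimum number of intervals (of the vertex order) into which $V(G)$ can be partitioned so that no two vertices in the same interval are adjacent. A graph is $d$-degenerate if each of its nonempty subgraphs has a vertex of degree at most $d$. $K_N^<$ is the ordered complete graph on $N$ vertices. The ordered Ramsey number $r_<(H^<;q)$ is the smallest $N$ such that every coloring of the edges of $K_N^<$ with $q$ colors contains a monochromatic ordered copy of $H^<$. *)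

theory Defs
  imports Complex_Main "HOL-Library.Ramsey" "HOL-Library.Disjoint_Sets"
begin

text \<open>
  The linear order on the vertex set is the one of the class \<open>linorder\<close>, restricted to \<open>V\<close>.
  Every finite linearly ordered set arises this way up to isomorphism (already inside \<open>nat\<close>).
\<close>

definition ordered_graph :: "'a::linorder set \<Rightarrow> 'a set set \<Rightarrow> bool" where
  "ordered_graph V E \<longleftrightarrow> finite V \<and> E \<subseteq> [V]\<^bsup>2\<^esup>"

definition subgraph :: "'a set \<Rightarrow> 'a set set \<Rightarrow> 'a set \<Rightarrow> 'a set set \<Rightarrow> bool" where
  "subgraph W F V E \<longleftrightarrow> W \<subseteq> V \<and> F \<subseteq> E \<and> F \<subseteq> [W]\<^bsup>2\<^esup>"

definition degree :: "'a set \<Rightarrow> 'a set set \<Rightarrow> 'a \<Rightarrow> nat" where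
  "degree V E v = card {w \<in> V. {v, w} \<in> E}"

definition degenerate :: "nat \<Rightarrow> 'a set \<Rightarrow> 'a set set \<Rightarrow> bool" where
  "degenerate d V E \<longleftrightarrow>
     (\<forall>W F. subgraph W F V E \<and> W \<noteq> {} \<longrightarrow> (\<exists>v\<in>W. degree W F v \<le> d))"

definition triangle_free :: "'a set \<Rightarrow> 'a set set \<Rightarrow> bool" where
  "triangle_free V E \<longleftrightarrow>
     \<not> (\<exists>x\<in>V. \<exists>y\<in>V. \<exists>z\<in>V. {x, y} \<in> E \<and> {y, z} \<in> E \<and> {x, z} \<in> E)"

definition independent_set :: "'a set set \<Rightarrow> 'a set \<Rightarrow> bool" where
  "independent_set E I \<longleftrightarrow> (\<forall>u\<in>I. \<forall>v\<in>I. {u, v} \<notin> E)"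

definition interval_of :: "'a::linorder set \<Rightarrow> 'a set \<Rightarrow> bool" where
  "interval_of V I \<longleftrightarrow> I \<subseteq> V \<and> (\<forall>x\<in>I. \<forall>z\<in>I. \<forall>y\<in>V. x \<le> y \<and> y \<le> z \<longrightarrow> y \<in> I)"

definition interval_partition :: "'a::linorder set \<Rightarrow> 'a set set \<Rightarrow> 'a set set \<Rightarrow> bool" where
  "interval_partition V E P \<longleftrightarrow>
     partition_on V P \<and> (\<forall>I\<in>P. interval_of V I \<and> independent_set E I)"

definition interval_chromatic_number :: "'a::linorder set \<Rightarrow> 'a set set \<Rightarrow> nat" where
  "interval_chromatic_number V E = (LEAST k. \<exists>P. interval_partition V E P \<and> card P = k)"

definition ordered_copy ::
  "('a::linorder \<Rightarrow> 'b::linorder) \<Rightarrow> 'a set \<Rightarrow> 'a set set \<Rightarrow> 'b set \<Rightarrow> 'b set set \<Rightarrow> bool" where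
  "ordered_copy f V E V' E' \<longleftrightarrow>
     strict_mono_on V f \<and> f ` V \<subseteq> V' \<and> (\<forall>u\<in>V. \<forall>v\<in>V. {u, v} \<in> E \<longrightarrow> {f u, f v} \<in> E')"

text \<open>The ordered complete graph on \<open>N\<close> vertices has vertex set \<open>{..<N}\<close> and edge set \<open>[{..<N}]\<^bsup>2\<^esup>\<close>.\<close>

definition ordered_arrows :: "nat \<Rightarrow> 'a::linorder set \<Rightarrow> 'a set set \<Rightarrow> nat \<Rightarrow> bool" where
  "ordered_arrows N V E q \<longleftrightarrow>
     (\<forall>c \<in> [{..<N}]\<^bsup>2\<^esup> \<rightarrow> {..<q}. \<exists>i<q. \<exists>f. ordered_copy f V E {..<N} ([{..<N}]\<^bsup>2\<^esup>) \<and>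
        (\<forall>u\<in>V. \<forall>v\<in>V. {u, v} \<in> E \<longrightarrow> c {f u, f v} = i))"

definition ordered_ramsey_number :: "'a::linorder set \<Rightarrow> 'a set set \<Rightarrow> nat \<Rightarrow> nat" where
  "ordered_ramsey_number V E q = (LEAST N. ordered_arrows N V E q)"

text \<open>Both minima above are taken over nonempty sets, so \<open>LEAST\<close> is meaningful:
  singletons form an interval partition, and Ramsey's theorem bounds the ordered Ramsey number.\<close>

lemma interval_partition_exists:
  assumes "ordered_graph V E"
  shows "\<exists>P. interval_partition V E P"
proof
  show "interval_partition V E ((\<lambda>x. {x}) ` V)"
    using assms
    by (auto simp: interval_partition_def partition_on_singletons interval_of_def
        independent_set_def ordered_graph_def nsets_def)
qed

lemma strict_mono_enumeration:
  fixes V :: "'a::linorder set" and H :: "nat set"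
  assumes "finite V" "finite H" "card H = card V"
  shows "\<exists>f. strict_mono_on V f \<and> f ` V \<subseteq> H"
proof -
  let ?r = "\<lambda>v. card {x\<in>V. x < v}"
  let ?f = "\<lambda>v. sorted_list_of_set H ! ?r v"
  have r: "?r v < card H" if "v \<in> V" for v
    unfolding assms(3) using that assms(1) by (intro psubset_card_mono) auto
  have "?r u < ?r v" if "u \<in> V" "v \<in> V" "u < v" for u v
    using that assms(1) by (intro psubset_card_mono) auto
  then have "strict_mono_on V ?f"
    using r sorted_wrt_nth_less[OF strict_sorted_list_of_set[of H]]
    by (intro strict_mono_onI) auto
  moreover have "?f v \<in> H" if "v \<in> V" for v
    using r[OF that] assms(2)
      nth_mem[of "?r v" "sorted_list_of_set H"] by simp
  ultimately show ?thesis by blast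
qed

lemma ordered_arrows_exists:
  assumes "ordered_graph V E"
  shows "\<exists>N. ordered_arrows N V E q"
proof -
  obtain N :: nat where N: "partn_lst {..<N} (replicate q (card V)) 2"
    using ramsey_full by blast
  have "ordered_arrows N V E q"
    unfolding ordered_arrows_def
  proof
    fix c :: "nat set \<Rightarrow> nat" assume "c \<in> [{..<N}]\<^bsup>2\<^esup> \<rightarrow> {..<q}"
    then obtain i H where i: "i < q" and H: "H \<in> nsets {..<N} (card V)" "c ` nsets H 2 \<subseteq> {i}"
      using N unfolding partn_lst_def monochromatic_def length_replicate
      by (metis (no_types, lifting) nth_replicate)
    obtain f where f: "strict_mono_on V f" "f ` V \<subseteq> H"
      using strict_mono_enumeration[of V H] assms H(1)
      by (auto simp: ordered_graph_def nsets_def)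
    have e: "{f u, f v} \<in> nsets H 2" if "u \<in> V" "v \<in> V" "{u, v} \<in> E" for u v
    proof -
      have "u \<noteq> v" using that(3) assms by (auto simp: ordered_graph_def nsets_def)
      then have "f u \<noteq> f v"
        using f(1) that by (metis inj_on_def strict_mono_on_imp_inj_on)
      then show ?thesis using f(2) that by auto
    qed
    have "H \<subseteq> {..<N}" using H(1) by (simp add: nsets_def)
    then have "ordered_copy f V E {..<N} ([{..<N}]\<^bsup>2\<^esup>)"
      using f e nsets_mono[of H "{..<N}" 2] unfolding ordered_copy_def by blast
    moreover have "\<forall>u\<in>V. \<forall>v\<in>V. {u, v} \<in> E \<longrightarrow> c {f u, f v} = i"
      using e H(2) by blast
    ultimately show "\<exists>i<q. \<exists>f. ordered_copy f V E {..<N} ([{..<N}]\<^bsup>2\<^esup>) \<and>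
        (\<forall>u\<in>V. \<forall>v\<in>V. {u, v} \<in> E \<longrightarrow> c {f u, f v} = i)"
      using i by blast
  qed
  then show ?thesis ..
qed

end

theory Submission
  imports Defs
begin

text \<open>
  Suppose a \<open>q\<close>-colouring of the complete graph on \<open>N\<close> vertices has no monochromatic copy of \<open>H\<close>.
  By induction on \<open>k\<close>, every large vertex set contains two large sets, one to the left of the other,
  with few edges of colours \<open>< k\<close> between them; for \<open>k = q\<close> this is absurd. In the induction step,
  such pairs are first nested into \<open>2 ^ L \<ge> \<chi>\<close> consecutive sets that are pairwise sparse in the
  colours \<open>< k\<close>, at the price of a factor \<open>L = \<lceil>log \<chi>\<rceil>\<close> in the exponent. Then \<open>H\<close> is embedded
  greedily in colour \<open>k\<close> into these sets along a degenerate ordering, shrinking the candidate sets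
  of the neighbours of each embedded vertex. Throughout, the sum of the densities in colours \<open>< k\<close>
  over the edges of \<open>H\<close> between candidate sets must grow by at most \<open>1 + 1 / n\<close> per step. As \<open>H\<close> is
  triangle-free, no edge has both of its candidate sets shrunk at once, so it suffices to restrict
  each shrunk set beforehand to its vertices of nearly average weight. When the embedding gets stuck
  in colour \<open>k\<close>, the two candidate sets responsible are also sparse in the colours \<open>< k\<close>, which is
  a sparse pair for \<open>k + 1\<close>.
\<close>

section \<open>Averaging\<close>

text \<open>Markov's inequality. With \<open>l = 1 + 1 / n\<close> at least a fraction
  \<open>1 / (n + 1)\<close> of the set stays within a factor \<open>l\<close> of the mean; with
  \<open>l = 2\<close> at least half stays within twice the mean.\<close>

lemma card_le_multiple_of_mean:
  fixes w :: "'b \<Rightarrow> real"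
  assumes "finite X" and "\<And>x. x \<in> X \<Longrightarrow> 0 \<le> w x" and "0 < l"
  shows "(1 - 1 / l) * card X \<le> card {x \<in> X. w x \<le> l * (sum w X / card X)}"
\<comment> \<open>The zero case includes empty \<open>X\<close>, so afterwards both the total and
  \<open>card X\<close> are positive.\<close>
proof (cases "sum w X = 0")
  case True
  then have "{x \<in> X. w x \<le> l * (sum w X / card X)} = X"
    using assms sum_nonneg_eq_0_iff[of X w] by auto
  then show ?thesis using \<open>0 < l\<close> by (simp add: mult_left_le_one_le algebra_simps)
next
  case False
  then have pos: "0 < sum w X" using assms sum_nonneg[of X w] by force
  then have X: "0 < real (card X)"
    using assms(1) by (metis card_gt_0_iff of_nat_0_less_iff less_irrefl sum.empty)
  let ?A = "{x \<in> X. w x \<le> l * (sum w X / card X)}"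
  let ?B = "{x \<in> X. l * (sum w X / card X) < w x}"
  have "card ?B * (l * (sum w X / card X)) \<le> sum w ?B"
    by (rule sum_bounded_below) auto
  also have "\<dots> \<le> sum w X" using assms by (intro sum_mono2) auto
  finally have B: "card ?B * l \<le> card X"
    using pos X by (simp add: field_simps)
  have "card X = card ?A + card ?B"
    using assms(1) by (subst card_Un_disjoint[symmetric]) (auto intro!: arg_cong[where f = card])
  then have AB: "real (card X) = real (card ?A) + card ?B" by simp
  have "(1 - 1 / l) * x \<le> a" if "b * l \<le> x" "x = a + b" for x a b :: real
    using that \<open>0 < l\<close> by (simp add: field_simps)
  from this[OF B AB] show ?thesis .
qed

text \<open>Deleting an element of maximal weight does not raise the mean; this is repeated until
  \<open>m\<close> elements remain. The comparison of means is multiplied out, which avoids dividing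
  by zero.\<close>

lemma subset_with_small_mean:
  fixes w :: "'b \<Rightarrow> real"
  assumes "finite X" and "m \<le> card X"
  shows "\<exists>Y\<subseteq>X. card Y = m \<and> sum w Y * card X \<le> m * sum w X"
  using assms
proof (induction "card X - m" arbitrary: X)
  case 0
  then show ?case by (intro exI[of _ X]) auto
next
  case (Suc k)
  then have "X \<noteq> {}" by auto
  then have "Max (w ` X) \<in> w ` X" using Suc.prems(1) by (intro Max_in) auto
  then obtain x where "x \<in> X" "Max (w ` X) = w x" by blast
  then have x: "x \<in> X" "\<And>y. y \<in> X \<Longrightarrow> w y \<le> w x"
    using Max_ge[of "w ` X"] Suc.prems(1) by auto
  let ?X = "X - {x}"
  have c: "card X = Suc (card ?X)" using x Suc.prems(1) by (metis card.remove)
  have "k = card ?X - m" "m \<le> card ?X" using Suc.hyps(2) c by auto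
  then obtain Y where Y: "Y \<subseteq> ?X" "card Y = m" "sum w Y * card ?X \<le> m * sum w ?X"
    using Suc.hyps(1)[of ?X] Suc.prems(1) by auto
  have s: "sum w X = w x + sum w ?X" using x Suc.prems(1) by (simp add: sum.remove)
  \<comment> \<open>Added to the bound for \<open>?X\<close> this gives the claim, since
    \<open>card X\<close> exceeds \<open>card ?X\<close> by one and \<open>sum w X\<close> exceeds
    \<open>sum w ?X\<close> by \<open>w x\<close>.\<close>
  have "sum w Y \<le> m * w x"
    using sum_bounded_above[of Y w "w x"] Y x by auto
  then have "sum w Y * card X \<le> m * sum w X"
    using Y(3) unfolding s c by (simp add: algebra_simps)
  then show ?case using Y by blast
qed

section \<open>Counting related pairs\<close>

definition edges_between :: "('b \<Rightarrow> 'c \<Rightarrow> bool) \<Rightarrow> 'b set \<Rightarrow> 'c set \<Rightarrow> real" where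
  "edges_between R X Y = (\<Sum>x\<in>X. \<Sum>y\<in>Y. of_bool (R x y))"

text \<open>Division by zero gives 0, so an empty side has density 0 and the averaging identity
  \<open>density_mean_left\<close> covers that case too.\<close>

definition density :: "('b \<Rightarrow> 'c \<Rightarrow> bool) \<Rightarrow> 'b set \<Rightarrow> 'c set \<Rightarrow> real" where
  "density R X Y = edges_between R X Y / (card X * card Y)"

lemma edges_between_nonneg: "0 \<le> edges_between R X Y"
  by (simp add: edges_between_def sum_nonneg)

lemma density_nonneg: "0 \<le> density R X Y"
  by (simp add: density_def edges_between_nonneg)

lemma edges_between_mono:
  assumes "finite X'" "finite Y'" "X \<subseteq> X'" "Y \<subseteq> Y'"
  shows "edges_between R X Y \<le> edges_between R X' Y'"
proof -
  have "edges_between R X Y \<le> (\<Sum>x\<in>X. \<Sum>y\<in>Y'. of_bool (R x y))"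
    unfolding edges_between_def using assms by (intro sum_mono sum_mono2) auto
  also have "\<dots> \<le> edges_between R X' Y'"
    unfolding edges_between_def using assms by (intro sum_mono2) (auto intro: sum_nonneg)
  finally show ?thesis .
qed

lemma edges_between_sym: "symp R \<Longrightarrow> edges_between R X Y = edges_between R Y X"
  unfolding edges_between_def symp_def
  by (subst sum.swap) (intro sum.cong refl arg_cong[where f = of_bool], blast)

lemma density_sym: "symp R \<Longrightarrow> density R X Y = density R Y X"
  by (simp add: density_def edges_between_sym[of R X Y] mult.commute)

lemma edges_between_sum_left: "edges_between R X Y = (\<Sum>x\<in>X. edges_between R {x} Y)"
  by (simp add: edges_between_def)

lemma edges_between_sum_right: "edges_between R X Y = (\<Sum>y\<in>Y. edges_between R X {y})"
  unfolding edges_between_def by (subst sum.swap) (simp del: sum_of_bool_eq)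

lemma density_mean_left: "density R X Y = (\<Sum>x\<in>X. density R {x} Y) / card X"
  unfolding density_def
  by (subst edges_between_sum_left) (simp add: sum_divide_distrib mult.commute)

lemma edges_between_singleton: "finite Y \<Longrightarrow> edges_between R {x} Y = card {y \<in> Y. R x y}"
  by (simp add: edges_between_def Int_def)

text \<open>Brings a sparse pair to the exact size that \<open>sparse_pairs\<close> prescribes. The
  left side is trimmed first, and the right side is then weighed against the trimmed left side, so
  neither step raises the density.\<close>

lemma edges_between_trim:
  fixes t :: real
  assumes "finite X" "finite Y" "m \<le> card X" "m \<le> card Y"
    and "edges_between R X Y \<le> t * (card X * card Y)"
  shows "\<exists>X' Y'. X' \<subseteq> X \<and> Y' \<subseteq> Y \<and> card X' = m \<and> card Y' = m \<and>
    edges_between R X' Y' \<le> t * m\<^sup>2"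
proof (cases "m = 0")
  case True
  then show ?thesis by (intro exI[of _ "{}"]) (auto simp: edges_between_def)
next
  case False
  then have pos: "0 < real (card X)" "0 < real (card Y)" using assms by auto
  obtain X' where X': "X' \<subseteq> X" "card X' = m"
    "edges_between R X' Y * card X \<le> m * edges_between R X Y"
    using subset_with_small_mean[OF assms(1,3), of "\<lambda>x. edges_between R {x} Y"]
    by (metis edges_between_sum_left)
  obtain Y' where Y': "Y' \<subseteq> Y" "card Y' = m"
    "edges_between R X' Y' * card Y \<le> m * edges_between R X' Y"
    using subset_with_small_mean[OF assms(2,4), of "\<lambda>y. edges_between R X' {y}"]
    by (metis edges_between_sum_right)
  have "edges_between R X' Y * card X \<le> m * (t * (card X * card Y))"
    using X'(3) assms(5) by (meson mult_left_mono of_nat_0_le_iff order_trans)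
  then have "edges_between R X' Y \<le> m * (t * card Y)"
    using pos by (simp add: mult_ac)
  then have "edges_between R X' Y' * card Y \<le> m * (m * (t * card Y))"
    using Y'(3) by (meson mult_left_mono of_nat_0_le_iff order_trans)
  then have "edges_between R X' Y' \<le> t * m\<^sup>2"
    using pos by (simp add: power2_eq_square mult_ac)
  then show ?thesis using X' Y' by blast
qed

section \<open>Orderings of degenerate graphs and interval partitions\<close>

text \<open>A vertex of degree at most \<open>d\<close> in the induced subgraph is removed and
  placed last; the rest is ordered by induction.\<close>

lemma degenerate_ordering:
  assumes "finite V" "degenerate d V E" "E \<subseteq> [V]\<^bsup>2\<^esup>"
  shows "\<exists>r. bij_betw r V {..<card V} \<and>
    (\<forall>v\<in>V. card {w \<in> V. {v, w} \<in> E \<and> r w < r v} \<le> d)"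
proof -
  have "\<exists>r. bij_betw r A {..<card A} \<and> (\<forall>v\<in>A. card {w \<in> A. {v, w} \<in> E \<and> r w < r v} \<le> d)"
    if "A \<subseteq> V" for A
    using that
  proof (induction "card A" arbitrary: A)
    case 0
    then have "A = {}" using assms(1) finite_subset[of A V] by simp
    then show ?case by (auto simp: bij_betw_def)
  next
    case (Suc k)
    have fin: "finite A" using Suc.prems assms(1) finite_subset by blast
    let ?F = "{e \<in> E. e \<subseteq> A}"
    have "subgraph A ?F V E"
      using Suc.prems assms(3) by (auto simp: subgraph_def nsets_def)
    then obtain v where v: "v \<in> A" "degree A ?F v \<le> d"
      using assms(2) Suc.hyps(2) unfolding degenerate_def by fastforce
    let ?A = "A - {v}"
    have c: "card ?A = k" using v fin Suc.hyps(2) by simp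
    obtain r where r: "bij_betw r ?A {..<k}"
      "\<And>u. u \<in> ?A \<Longrightarrow> card {w \<in> ?A. {u, w} \<in> E \<and> r w < r u} \<le> d"
      using Suc.hyps(1)[of ?A] c Suc.prems by auto
    \<comment> \<open>In last position, \<open>v\<close> has all its neighbours in \<open>A\<close>
      before it, which are at most \<open>d\<close>, and it enters no other vertex's count.\<close>
    let ?r = "r(v := k)"
    have lt: "r w < k" if "w \<in> ?A" for w using r(1) that bij_betwE by blast
    have "bij_betw ?r ?A {..<k}" using r(1) by (subst bij_betw_cong[where g = r]) auto
    then have "bij_betw ?r (insert v ?A) (insert (?r v) {..<k})"
      using notIn_Un_bij_betw[of v ?A ?r "{..<k}"] by simp
    then have b: "bij_betw ?r A {..<card A}"
      using v(1) Suc.hyps(2) by (simp add: insert_absorb lessThan_Suc[symmetric])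
    have "card {w \<in> A. {u, w} \<in> E \<and> ?r w < ?r u} \<le> d" if u: "u \<in> A" for u
    proof (cases "u = v")
      case True
      have "{w \<in> A. {u, w} \<in> E \<and> ?r w < ?r u} \<subseteq> {w \<in> A. {v, w} \<in> ?F}"
        using True v(1) by auto
      then show ?thesis
        using v(2) fin card_mono[of "{w \<in> A. {v, w} \<in> ?F}"] unfolding degree_def
        by (metis (no_types, lifting) finite_subset mem_Collect_eq order_trans subsetI)
    next
      case False
      then have "{w \<in> A. {u, w} \<in> E \<and> ?r w < ?r u} = {w \<in> ?A. {u, w} \<in> E \<and> r w < r u}"
        using lt[of u] u by auto
      then show ?thesis using r(2)[of u] u False by simp
    qed
    then show ?case using b by blast
  qed
  then show ?thesis by blast
qed

text \<open>In an optimal partition, a vertex is coloured by the number of intervals lying entirely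
  before it. Its own interval is never counted, whence the strict bound. If \<open>u < v\<close> are
  adjacent, the interval of \<open>u\<close> misses \<open>v\<close> by independence, so it counts
  for \<open>v\<close> but not for \<open>u\<close>.\<close>

lemma interval_chromatic_number_colouring:
  assumes "ordered_graph V E"
  shows "\<exists>p. (\<forall>v\<in>V. p v < interval_chromatic_number V E) \<and> mono_on V p \<and>
    (\<forall>u\<in>V. \<forall>v\<in>V. {u, v} \<in> E \<longrightarrow> p u \<noteq> p v)"
proof -
  have fin: "finite V" using assms by (simp add: ordered_graph_def)
  obtain P where P: "interval_partition V E P" "card P = interval_chromatic_number V E"
    unfolding interval_chromatic_number_def
    using interval_partition_exists[OF assms]
      LeastI_ex[of "\<lambda>k. \<exists>P. interval_partition V E P \<and> card P = k"] by auto
  have un: "\<Union>P = V" and part: "\<And>I. I \<in> P \<Longrightarrow> interval_of V I"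
      "\<And>I. I \<in> P \<Longrightarrow> independent_set E I"
    using P(1) by (auto simp: interval_partition_def partition_on_def)
  have finP: "finite P" using un fin by (metis finite_UnionD)
  define p where "p v = card {I \<in> P. \<forall>x\<in>I. x < v}" for v
  have "p v < card P" if v: "v \<in> V" for v
  proof -
    obtain I where "I \<in> P" "v \<in> I" using v un by auto
    then show ?thesis unfolding p_def using finP by (intro psubset_card_mono) auto
  qed
  moreover have "mono_on V p"
    unfolding p_def using finP by (intro mono_onI card_mono) auto
  moreover have ne: "p u \<noteq> p v" if uv: "u \<in> V" "v \<in> V" "{u, v} \<in> E" "u < v" for u v
  proof -
    obtain I where I: "I \<in> P" "u \<in> I" using uv(1) un by auto
    then have "v \<notin> I" using uv(3) part(2)[of I] by (auto simp: independent_set_def)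
    then have "\<forall>x\<in>I. x < v"
      using part(1)[OF I(1)] I uv(2,4) unfolding interval_of_def by (meson leI less_imp_le)
    then have "p u < p v"
      unfolding p_def using finP I uv(4) by (intro psubset_card_mono) (auto dest: less_trans)
    then show ?thesis by simp
  qed
  moreover have "p u \<noteq> p v" if "u \<in> V" "v \<in> V" "{u, v} \<in> E" for u v
  proof -
    have "u \<noteq> v" using that(3) assms by (auto simp: ordered_graph_def nsets_def)
    then show ?thesis using ne[of u v] ne[of v u] that by (metis insert_commute linorder_neqE)
  qed
  ultimately show ?thesis using P(2) by auto
qed

lemma interval_chromatic_number_le_card:
  assumes "ordered_graph V E"
  shows "interval_chromatic_number V E \<le> card V"
proof -
  have "interval_partition V E ((\<lambda>x. {x}) ` V)"
    using assms
    by (auto simp: interval_partition_def partition_on_singletons interval_of_def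
        independent_set_def ordered_graph_def nsets_def)
  moreover have "card ((\<lambda>x. {x}) ` V) = card V" by (simp add: card_image)
  ultimately show ?thesis unfolding interval_chromatic_number_def by (intro Least_le) blast
qed

text \<open>The sorted list of \<open>S\<close> is cut into runs of length \<open>m\<close>. This
  serves the base case of the tuples and later provides separate candidate sets for vertices in the
  same interval.\<close>

lemma consecutive_blocks:
  fixes S :: "nat set"
  assumes "finite S" "r * m \<le> card S"
  shows "\<exists>g. (\<forall>i<r. g i \<subseteq> S \<and> card (g i) = m) \<and>
    (\<forall>i<r. \<forall>j<r. i < j \<longrightarrow> (\<forall>x\<in>g i. \<forall>y\<in>g j. x < y))"
proof -
  define l where "l = sorted_list_of_set S"
  define g where "g i = (\<lambda>t. l ! t) ` {i * m..<Suc i * m}" for i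
  have len: "length l = card S" and set: "set l = S" and dist: "distinct l"
    using assms(1) by (auto simp: l_def)
  have bound: "t < length l" if "i < r" "t < Suc i * m" for i t
  proof -
    have "Suc i * m \<le> r * m" using that by (intro mult_right_mono) auto
    then show ?thesis using that assms(2) len by linarith
  qed
  have "g i \<subseteq> S \<and> card (g i) = m" if "i < r" for i
  proof
    show "g i \<subseteq> S" unfolding g_def using bound[OF that] set by auto
    have "inj_on (\<lambda>t. l ! t) {i * m..<Suc i * m}"
      using bound[OF that] dist by (auto simp: inj_on_def nth_eq_iff_index_eq)
    then show "card (g i) = m" unfolding g_def by (simp add: card_image)
  qed
  moreover have "x < y" if "i < r" "j < r" "i < j" "x \<in> g i" "y \<in> g j" for i j x y
  proof -
    obtain s t where st: "x = l ! s" "y = l ! t" "s < Suc i * m" "j * m \<le> t" "t < Suc j * m"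
      using \<open>x \<in> g i\<close> \<open>y \<in> g j\<close> unfolding g_def by auto
    have "Suc i * m \<le> j * m" using that by (intro mult_right_mono) auto
    then have "s < t" using st by linarith
    then show ?thesis
      using st bound[OF that(2)] sorted_wrt_nth_less[of "(<)" l s t]
        strict_sorted_list_of_set[of S] by (simp add: l_def)
  qed
  ultimately show ?thesis by blast
qed

section \<open>Greedy embedding\<close>

text \<open>The potential that the embedding keeps bounded. The sum is over ordered pairs, so each
  edge is counted in both directions.\<close>

definition total_density :: "('b \<Rightarrow> 'b \<Rightarrow> bool) \<Rightarrow> 'a set set \<Rightarrow> 'a set \<Rightarrow> ('a \<Rightarrow> 'b set) \<Rightarrow> real" where
  "total_density R E A B =
     (\<Sum>v\<in>A. \<Sum>w\<in>A. if {v, w} \<in> E then density R (B v) (B w) else 0)"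

text \<open>What the edges from \<open>w\<close> into \<open>Z\<close> would contribute if the
  candidate set of \<open>w\<close> were just \<open>{y}\<close>. By \<open>weight_mean\<close> the
  actual contribution is the mean of these weights.\<close>

definition weight :: "('b \<Rightarrow> 'b \<Rightarrow> bool) \<Rightarrow> 'a set set \<Rightarrow> 'a set \<Rightarrow> ('a \<Rightarrow> 'b set) \<Rightarrow> 'a \<Rightarrow> 'b \<Rightarrow> real" where
  "weight R E Z B w y = (\<Sum>z\<in>Z. if {w, z} \<in> E then density R {y} (B z) else 0)"

lemma total_density_nonneg: "0 \<le> total_density R E A B"
  unfolding total_density_def by (auto intro!: sum_nonneg density_nonneg)

lemma weight_nonneg: "0 \<le> weight R E Z B w y"
  unfolding weight_def by (auto intro!: sum_nonneg density_nonneg)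

lemma weight_mean:
  "(\<Sum>z\<in>Z. if {w, z} \<in> E then density R X (B z) else 0)
    = (\<Sum>y\<in>X. weight R E Z B w y) / card X"
proof -
  have "(\<Sum>y\<in>X. weight R E Z B w y) / card X
      = (\<Sum>z\<in>Z. (\<Sum>y\<in>X. if {w, z} \<in> E then density R {y} (B z) else 0) / card X)"
    unfolding weight_def by (subst sum.swap) (simp add: sum_divide_distrib)
  also have "\<dots> = (\<Sum>z\<in>Z. if {w, z} \<in> E then density R X (B z) else 0)"
    by (intro sum.cong refl) (simp add: density_mean_left[of R X])
  finally show ?thesis by simp
qed

lemma total_density_mono:
  assumes "finite A" "A' \<subseteq> A"
  shows "total_density R E A' B \<le> total_density R E A B"
proof -
  let ?D = "\<lambda>v w. if {v, w} \<in> E then density R (B v) (B w) else 0"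
  have "(\<Sum>v\<in>A'. \<Sum>w\<in>A'. ?D v w) \<le> (\<Sum>v\<in>A'. \<Sum>w\<in>A. ?D v w)"
    using assms by (intro sum_mono sum_mono2) (auto simp: density_nonneg)
  also have "\<dots> \<le> (\<Sum>v\<in>A. \<Sum>w\<in>A. ?D v w)"
    using assms by (intro sum_mono2 sum_nonneg) (auto simp: density_nonneg intro!: sum_nonneg)
  finally show ?thesis by (simp add: total_density_def)
qed

lemma density_le_total_density:
  assumes "finite A" "v \<in> A" "w \<in> A" "{v, w} \<in> E"
  shows "density R (B v) (B w) \<le> total_density R E A B"
proof -
  let ?D = "\<lambda>v w. if {v, w} \<in> E then density R (B v) (B w) else 0"
  have "density R (B v) (B w) = ?D v w" using assms by simp
  also have "\<dots> \<le> (\<Sum>w\<in>A. ?D v w)"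
    using assms by (intro member_le_sum) (auto simp: density_nonneg)
  also have "\<dots> \<le> (\<Sum>v\<in>A. \<Sum>w\<in>A. ?D v w)"
    using assms by (intro member_le_sum[of v A "\<lambda>v. \<Sum>w\<in>A. ?D v w"])
      (auto simp: density_nonneg intro!: sum_nonneg)
  finally show ?thesis by (simp add: total_density_def)
qed

text \<open>Independence of \<open>N\<close> kills the terms inside \<open>N\<close>, and symmetry
  of \<open>R\<close> makes the two mixed sums equal, whence the factor 2.\<close>

lemma total_density_split:
  assumes "finite A" "N \<subseteq> A" "symp R" and indep: "\<And>v w. v \<in> N \<Longrightarrow> w \<in> N \<Longrightarrow> {v, w} \<notin> E"
  shows "total_density R E A B = total_density R E (A - N) B
    + 2 * (\<Sum>w\<in>N. \<Sum>z\<in>A - N. if {w, z} \<in> E then density R (B w) (B z) else 0)"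
proof -
  let ?D = "\<lambda>v w. if {v, w} \<in> E then density R (B v) (B w) else 0"
  let ?Z = "A - N"
  have split: "sum f A = sum f ?Z + sum f N" for f :: "'a \<Rightarrow> real"
    using sum.subset_diff[OF assms(2,1)] .
  have "(\<Sum>v\<in>?Z. \<Sum>w\<in>N. ?D v w) = (\<Sum>w\<in>N. \<Sum>v\<in>?Z. ?D v w)"
    by (rule sum.swap)
  also have "\<dots> = (\<Sum>w\<in>N. \<Sum>z\<in>?Z. ?D w z)"
    using density_sym[OF assms(3)] by (intro sum.cong refl) (simp add: insert_commute)
  finally have ZN: "(\<Sum>v\<in>?Z. \<Sum>w\<in>N. ?D v w) = (\<Sum>w\<in>N. \<Sum>z\<in>?Z. ?D w z)" .
  have NN: "(\<Sum>v\<in>N. \<Sum>w\<in>N. ?D v w) = 0" using indep by (intro sum.neutral ballI) auto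
  have "total_density R E A B
      = (\<Sum>v\<in>?Z. (\<Sum>w\<in>?Z. ?D v w) + (\<Sum>w\<in>N. ?D v w)) + (\<Sum>v\<in>N. (\<Sum>w\<in>?Z. ?D v w) + (\<Sum>w\<in>N. ?D v w))"
    unfolding total_density_def split[of "\<lambda>w. ?D _ w"] by (rule split)
  also have "\<dots> = (\<Sum>v\<in>?Z. \<Sum>w\<in>?Z. ?D v w) + 2 * (\<Sum>w\<in>N. \<Sum>z\<in>?Z. ?D w z)"
    by (simp only: sum.distrib ZN NN)
  finally show ?thesis by (simp add: total_density_def)
qed

text \<open>Because the neighbourhood \<open>N\<close> of the vertex being embedded is independent, the total density
  is affine in the new candidate sets, so it can be controlled by one weight function per set.\<close>

lemma total_density_shrink:
  fixes B B' :: "'a \<Rightarrow> 'b set"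
  assumes "finite A" "N \<subseteq> A" "symp R" "\<And>v w. v \<in> N \<Longrightarrow> w \<in> N \<Longrightarrow> {v, w} \<notin> E"
    and l: "1 \<le> l"
    and same: "\<And>z. z \<in> A - N \<Longrightarrow> B' z = B z"
    and light: "\<And>w y. w \<in> N \<Longrightarrow> y \<in> B' w \<Longrightarrow> weight R E (A - N) B w y
      \<le> l * ((\<Sum>y\<in>B w. weight R E (A - N) B w y) / card (B w))"
  shows "total_density R E A B' \<le> l * total_density R E A B"
proof -
  let ?Z = "A - N"
  let ?S = "\<lambda>B w. \<Sum>z\<in>?Z. if {w, z} \<in> E then density R (B w) (B z) else 0"
  have "total_density R E ?Z B' = total_density R E ?Z B"
    unfolding total_density_def using same by (intro sum.cong) auto
  moreover have "total_density R E ?Z B \<le> l * total_density R E ?Z B"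
    using mult_right_mono[OF l total_density_nonneg, of R E ?Z B] by simp
  moreover have "?S B' w \<le> l * ?S B w" if w: "w \<in> N" for w
  proof -
    let ?t = "l * ((\<Sum>y\<in>B w. weight R E ?Z B w y) / card (B w))"
    have "?S B' w = (\<Sum>z\<in>?Z. if {w, z} \<in> E then density R (B' w) (B z) else 0)"
      using same by (intro sum.cong) auto
    also have "\<dots> = (\<Sum>y\<in>B' w. weight R E ?Z B w y) / card (B' w)"
      by (rule weight_mean)
    also have "\<dots> \<le> ?t"
    \<comment> \<open>An empty new candidate set has mean 0 by the convention on division.\<close>
    proof (cases "card (B' w) = 0")
      case True
      then show ?thesis using l weight_nonneg[of R E ?Z B w]
        by (simp add: sum_nonneg)
    next
      case False
      then show ?thesis
        using sum_bounded_above[of "B' w" "weight R E ?Z B w" ?t] light[OF w]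
        by (simp add: divide_le_eq algebra_simps)
    qed
    finally show ?thesis by (simp only: weight_mean)
  qed
  then have "(\<Sum>w\<in>N. ?S B' w) \<le> l * (\<Sum>w\<in>N. ?S B w)"
    by (simp add: sum_distrib_left sum_mono)
  ultimately show ?thesis
    by (simp add: total_density_split[OF assms(1-4), of B] total_density_split[OF assms(1-4), of B']
        distrib_left)
qed

text \<open>Source of the constant 3 below: the potential grows by a factor \<open>1 + 1 / n\<close>
  in each of at most \<open>n\<close> steps.\<close>

lemma one_plus_inverse_power_le_3:
  assumes "i \<le> n" "0 < n"
  shows "(1 + 1 / real n) ^ i \<le> 3"
proof -
  have "(1 + 1 / real n) ^ i \<le> (1 + 1 / real n) ^ n"
    using assms by (intro power_increasing) auto
  also have "\<dots> \<le> exp (1 / real n) ^ n"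
    by (intro power_mono exp_ge_add_one_self) auto
  also have "\<dots> = exp 1" using assms by (simp flip: exp_of_nat_mult)
  also have "\<dots> \<le> 3" by (rule exp_le)
  finally show ?thesis .
qed

text \<open>\<open>R\<close> stands for the colours below \<open>k\<close> and \<open>Q\<close> for
  colour \<open>k\<close>. Each embedded neighbour costs a candidate set a factor
  \<open>a * (n + 1)\<close>: \<open>n + 1\<close> for keeping only vertices of small weight and
  \<open>a\<close> for keeping only the \<open>Q\<close>-neighbours of the chosen vertex. This
  happens at most \<open>d\<close> times, so \<open>(n + 1) * m\<close> candidates always survive,
  enough to yield two sets of size \<open>m\<close> when the embedding gets stuck.\<close>

lemma embedding_or_sparse_pair:
  fixes V :: "'a set" and W :: "'a \<Rightarrow> 'b set" and R Q :: "'b \<Rightarrow> 'b \<Rightarrow> bool"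
    and a m :: nat and s :: real
  assumes fin: "finite V" and n: "card V = n" "0 < n" and EV: "E \<subseteq> [V]\<^bsup>2\<^esup>"
    and tf: "triangle_free V E" and deg: "degenerate d V E"
    and sym: "symp R" "symp Q"
    and W: "\<And>v. v \<in> V \<Longrightarrow> finite (W v)"
      "\<And>v. v \<in> V \<Longrightarrow> (a * (n + 1)) ^ d * ((n + 1) * m) \<le> card (W v)"
    and pos: "0 < a" "0 < m" and s: "total_density R E V W \<le> s"
  shows "(\<exists>f. (\<forall>v\<in>V. f v \<in> W v) \<and> (\<forall>u\<in>V. \<forall>v\<in>V. {u, v} \<in> E \<longrightarrow> Q (f u) (f v))) \<or>
    (\<exists>u\<in>V. \<exists>w\<in>V. \<exists>X Y. {u, w} \<in> E \<and> X \<subseteq> W u \<and> Y \<subseteq> W w \<and> m \<le> card X \<and> m \<le> card Y \<and>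
      edges_between R X Y \<le> 3 * real n * real (n + 1) * s * real (card X * card Y) \<and>
      edges_between Q X Y \<le> 1 / real a * real (card X * card Y))" (is "?copy \<or> ?sparse")
proof (rule disjCI)
  assume no_sparse: "\<not> ?sparse"
  obtain r where r: "bij_betw r V {..<n}"
    "\<And>v. v \<in> V \<Longrightarrow> card {w \<in> V. {v, w} \<in> E \<and> r w < r v} \<le> d"
    using degenerate_ordering[OF fin deg EV] n(1) by blast
  define b where "b = a * (n + 1)"
  define M where "M = (n + 1) * m"
  define l where "l = 1 + 1 / real n"
  have b: "0 < b" and l: "1 \<le> l" using pos by (auto simp: b_def l_def)
  define rest where "rest i = {v \<in> V. i \<le> r v}" for i
  define earlier where "earlier i w = {v \<in> V. {w, v} \<in> E \<and> r v < i}" for i w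
  \<comment> \<open>The state after embedding the first \<open>i\<close> vertices in the degenerate
    ordering. The size bound is multiplied out to avoid division, and the potential runs only over
    vertices not yet embedded.\<close>
  define state where "state i B \<longleftrightarrow>
      (\<forall>v\<in>V. B v \<subseteq> W v) \<and> (\<forall>v\<in>V. r v < i \<longrightarrow> B v \<noteq> {}) \<and>
      (\<forall>u\<in>V. \<forall>w\<in>V. {u, w} \<in> E \<and> r u < i \<longrightarrow> (\<forall>x\<in>B u. \<forall>y\<in>B w. Q x y)) \<and>
      (\<forall>w\<in>rest i. b ^ d * M \<le> card (B w) * b ^ card (earlier i w)) \<and>
      total_density R E (rest i) B \<le> l ^ i * s" for i B
  have irrefl: "{v, v} \<notin> E" for v using EV by (auto simp: nsets_def)
  have "\<exists>B. state i B" if "i \<le> n" for i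
    using that
  proof (induction i)
    case 0
    have "state 0 W"
      using W(2) s by (auto simp: state_def rest_def earlier_def b_def M_def)
    then show ?case by blast
  next
    case (Suc i)
    then obtain B where st: "state i B" by auto
    have finB: "finite (B v)" if "v \<in> V" for v
      using st W(1) that unfolding state_def by (meson finite_subset)
    obtain u where u: "u \<in> V" "r u = i"
      using r(1) Suc.prems by (metis Suc_le_eq bij_betw_iff_bijections lessThan_iff)
    have ru: "r v = i \<longleftrightarrow> v = u" if "v \<in> V" for v
      using r(1) u that by (metis bij_betw_inv_into_left)
    have rest_Suc: "rest (Suc i) = rest i - {u}"
      using ru unfolding rest_def by (auto simp: Suc_le_eq order_less_le)
    define N where "N = {w \<in> rest (Suc i). {u, w} \<in> E}"
    define Z where "Z = rest (Suc i) - N"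
    have NV: "N \<subseteq> rest (Suc i)" "rest (Suc i) \<subseteq> rest i" "rest i \<subseteq> V"
      by (auto simp: N_def rest_def)
    have finr: "finite (rest j)" for j using fin by (auto simp: rest_def)
    have finN: "finite N" using finr NV(1) finite_subset by blast
    have u_rest: "u \<in> rest i" using u by (simp add: rest_def)
    \<comment> \<open>All embedded neighbours of \<open>w\<close> precede it in the ordering, so
      there are at most \<open>d\<close> and the invariant leaves at least \<open>M\<close>
      candidates.\<close>
    have big: "M \<le> card (B w)" if "w \<in> rest i" for w
    proof -
      have "card (earlier i w) \<le> card {v \<in> V. {w, v} \<in> E \<and> r v < r w}"
        using that fin by (intro card_mono) (auto simp: earlier_def rest_def)
      also have "\<dots> \<le> d" using r(2) that by (auto simp: rest_def)
      finally have "b ^ card (earlier i w) \<le> b ^ d" using b by (intro power_increasing) auto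
      then have "b ^ d * M \<le> card (B w) * b ^ d"
        using st that unfolding state_def by (meson mult_le_mono2 order_trans)
      then show ?thesis using b by simp
    qed
    define \<phi> where "\<phi> w = weight R E Z B w" for w
    \<comment> \<open>The candidates of nearly average weight. Any subset of \<open>Y w\<close> may
      replace \<open>B w\<close> without raising the potential by more than the factor
      \<open>l\<close>.\<close>
    define Y where "Y w = {y \<in> B w. \<phi> w y \<le> l * ((\<Sum>y\<in>B w. \<phi> w y) / card (B w))}" for w
    have finY: "finite (Y w)" if "w \<in> V" for w using finB[OF that] by (simp add: Y_def)
    have cardY: "card (B w) \<le> (n + 1) * card (Y w)" if "w \<in> V" for w
    proof -
      have "(1 - 1 / l) * card (B w) \<le> card (Y w)"
        unfolding Y_def \<phi>_def using finB[OF that] l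
        by (intro card_le_multiple_of_mean weight_nonneg) auto
      moreover have "1 - 1 / l = 1 / real (n + 1)"
        using n(2) by (simp add: l_def field_simps)
      ultimately have "real (card (B w)) \<le> real ((n + 1) * card (Y w))"
        by (simp add: divide_le_eq algebra_simps)
      then show ?thesis by (simp only: of_nat_le_iff)
    qed
    \<comment> \<open>The images of \<open>u\<close> that would leave \<open>w\<close> too few
      candidates.\<close>
    define X where "X w = {x \<in> B u. card {y \<in> Y w. Q x y} * a < card (Y w)}" for w
    have X_small: "n * card (X w) < card (B u)" if w: "w \<in> N" for w
    proof (rule ccontr)
      assume "\<not> n * card (X w) < card (B u)"
      then have cX: "card (B u) \<le> n * card (X w)" by simp
      have wV: "w \<in> V" "w \<in> rest i" "{u, w} \<in> E" using w NV by (auto simp: N_def)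
      have "n * m \<le> n * card (X w)" using big[OF u_rest] cX unfolding M_def add_mult_distrib by linarith
      then have mX: "m \<le> card (X w)" using n(2) by simp
      have "(n + 1) * m \<le> (n + 1) * card (Y w)"
        using big[OF wV(2)] cardY[OF wV(1)] unfolding M_def by linarith
      then have mY: "m \<le> card (Y w)" by (metis Suc_eq_plus1 Suc_mult_le_cancel1)
      have sub: "X w \<subseteq> B u" "Y w \<subseteq> B w" by (auto simp: X_def Y_def)
      have "0 < real (card (B u) * card (B w))"
        using mX mY pos(2) sub finB[OF u(1)] finB[OF wV(1)]
        by (metis card_mono le_trans less_le_trans nat_0_less_mult_iff of_nat_0_less_iff)
      then have "edges_between R (B u) (B w) = density R (B u) (B w) * real (card (B u) * card (B w))"
        by (auto simp: density_def zero_less_mult_iff)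
      \<comment> \<open>\<open>X w\<close> is at least a fraction \<open>1 / n\<close> of
        \<open>B u\<close> and \<open>Y w\<close> at least \<open>1 / (n + 1)\<close> of
        \<open>B w\<close>, so restricting to them costs a factor \<open>n * (n + 1)\<close> in
        \<open>R\<close>-density.\<close>
      also have "\<dots> \<le> (3 * s) * real (n * card (X w) * ((n + 1) * card (Y w)))"
      proof (rule mult_mono)
        have d: "density R (B u) (B w) \<le> l ^ i * s"
          using density_le_total_density[OF finr u_rest wV(2,3), of R B] st
          unfolding state_def by linarith
        have "0 \<le> s" using s total_density_nonneg order_trans by blast
        then have "l ^ i * s \<le> 3 * s"
          using one_plus_inverse_power_le_3[of i n] Suc.prems n(2)
          unfolding l_def by (intro mult_right_mono) auto
        then show "density R (B u) (B w) \<le> 3 * s" "0 \<le> 3 * s" using d \<open>0 \<le> s\<close> by auto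
        show "real (card (B u) * card (B w)) \<le> real (n * card (X w) * ((n + 1) * card (Y w)))"
          using cX cardY[OF wV(1)] by (simp only: of_nat_le_iff mult_le_mono)
      qed simp
      finally have "edges_between R (B u) (B w)
          \<le> 3 * real n * real (n + 1) * s * real (card (X w) * card (Y w))"
        by (simp add: algebra_simps)
      then have eR: "edges_between R (X w) (Y w)
          \<le> 3 * real n * real (n + 1) * s * real (card (X w) * card (Y w))"
        using edges_between_mono[OF finB[OF u(1)] finB[OF wV(1)] sub] order_trans by blast
      have "edges_between Q {x} (Y w) \<le> card (Y w) / a" if "x \<in> X w" for x
      proof -
        have "real (card {y \<in> Y w. Q x y} * a) \<le> real (card (Y w))"
          using that unfolding X_def of_nat_le_iff by simp
        then show ?thesis
          using pos(1) finY[OF wV(1)] by (simp add: edges_between_singleton pos_le_divide_eq)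
      qed
      then have "edges_between Q (X w) (Y w) \<le> card (X w) * (card (Y w) / a)"
        by (subst edges_between_sum_left) (rule sum_bounded_above)
      then have eQ: "edges_between Q (X w) (Y w) \<le> 1 / real a * real (card (X w) * card (Y w))"
        by simp
      have "X w \<subseteq> W u" "Y w \<subseteq> W w"
        using sub st u(1) wV(1) unfolding state_def by blast+
      then show False using no_sparse u(1) wV mX mY eR eQ by blast
    qed
    \<comment> \<open>At most \<open>n\<close> neighbours each spoil less than a fraction
      \<open>1 / n\<close> of \<open>B u\<close>, so some image is good for all of them.\<close>
    have "card (\<Union>w\<in>N. X w) < card (B u)"
    proof (cases "N = {}")
      case True
      then show ?thesis using big[OF u_rest] pos(2) by (simp add: M_def)
    next
      case False
      have "n * card (\<Union>w\<in>N. X w) \<le> (\<Sum>w\<in>N. n * card (X w))"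
        using card_UN_le[OF finN, of X] by (simp flip: sum_distrib_left)
      also have "\<dots> < (\<Sum>w\<in>N. card (B u))"
        using X_small finN False by (intro sum_strict_mono)
      also have "\<dots> \<le> n * card (B u)"
        using card_mono[OF fin, of N] NV n(1) by auto
      finally show ?thesis by simp
    qed
    moreover have "finite (\<Union>w\<in>N. X w)" using finN finB[OF u(1)] by (simp add: X_def)
    ultimately have "\<not> B u \<subseteq> (\<Union>w\<in>N. X w)" using card_mono leD by blast
    then obtain x where x: "x \<in> B u" "\<And>w. w \<in> N \<Longrightarrow> x \<notin> X w" by blast
    define B' where "B' v = (if v = u then {x} else if v \<in> N then {y \<in> Y v. Q x y} else B v)" for v
    have uN: "u \<notin> N" using irrefl[of u] by (simp add: N_def)
    have B'B: "B' v \<subseteq> B v" for v using x(1) by (auto simp: B'_def Y_def)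
    have "state (Suc i) B'"
      unfolding state_def
    proof (intro conjI ballI impI)
      fix v assume v: "v \<in> V"
      show "B' v \<subseteq> W v" using B'B st v unfolding state_def by blast
      assume "r v < Suc i"
      then have "v = u \<or> r v < i" using ru v by (auto simp: less_Suc_eq)
      moreover have "v \<notin> N" using \<open>r v < Suc i\<close> by (auto simp: N_def rest_def)
      ultimately show "B' v \<noteq> {}" using st v by (auto simp: B'_def state_def)
    next
      fix v w y z assume H: "v \<in> V" "w \<in> V" "{v, w} \<in> E \<and> r v < Suc i" "y \<in> B' v" "z \<in> B' w"
      have BB: "y \<in> B v" "z \<in> B w" using H B'B by auto
      show "Q y z"
      proof (cases "r v < i")
        case True
        then show ?thesis using st H BB unfolding state_def by blast
      next
        case False
        then have vu: "v = u" using H ru by (auto simp: less_Suc_eq)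
        then have yx: "y = x" using H by (simp add: B'_def)
        show ?thesis
        proof (cases "r w < i")
          \<comment> \<open>An edge from \<open>u\<close> back to an embedded \<open>w\<close>: the
            invariant has it with \<open>w\<close> first, and symmetry of \<open>Q\<close> turns it
            around.\<close>
          case True
          have "{w, v} \<in> E" using H(3) by (simp add: insert_commute)
          then have "Q z y" using st True H(1,2) BB unfolding state_def by blast
          then show ?thesis by (rule sympD[OF sym(2)])
        next
          case False
          have "w \<noteq> u" using H(3) vu irrefl by auto
          then have "w \<in> N" using False H vu ru[OF H(2)] by (auto simp: N_def rest_def)
          then show ?thesis using H(5) yx \<open>w \<noteq> u\<close> by (simp add: B'_def)
        qed
      qed
    next
      fix w assume w: "w \<in> rest (Suc i)"
      then have w': "w \<in> rest i" "w \<in> V" "w \<noteq> u" using NV rest_Suc by auto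
      have old: "b ^ d * M \<le> card (B w) * b ^ card (earlier i w)"
        using st w' unfolding state_def by blast
      have finb: "finite (earlier i w)" using fin by (auto simp: earlier_def)
      show "b ^ d * M \<le> card (B' w) * b ^ card (earlier (Suc i) w)"
      proof (cases "w \<in> N")
        case True
        then have "{w, u} \<in> E" by (simp add: N_def insert_commute)
        then have "earlier (Suc i) w = insert u (earlier i w)"
          using u ru by (auto simp: earlier_def less_Suc_eq)
        then have Suc: "card (earlier (Suc i) w) = Suc (card (earlier i w))"
          using finb u(2) by (simp add: earlier_def)
        \<comment> \<open>Passing to \<open>Y w\<close> loses at most a factor \<open>n + 1\<close>,
          and \<open>x \<notin> X w\<close> bounds the further loss by \<open>a\<close>.\<close>
        have "card (B w) \<le> card (B' w) * b"
        proof -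
          have "card (Y w) \<le> card {y \<in> Y w. Q x y} * a"
            using x(2)[OF True] x(1) unfolding X_def by simp
          then have "(n + 1) * card (Y w) \<le> (n + 1) * (card (B' w) * a)"
            using w'(3) True by (intro mult_le_mono2) (simp add: B'_def)
          then show ?thesis using cardY[OF w'(2)] by (simp add: b_def algebra_simps)
        qed
        then have "card (B w) * b ^ card (earlier i w) \<le> card (B' w) * b * b ^ card (earlier i w)"
          by (rule mult_le_mono1)
        then show ?thesis using old unfolding Suc power_Suc mult.assoc by (rule le_trans[rotated])
      next
        case False
        then have "{w, u} \<notin> E" using w by (simp add: N_def insert_commute)
        then have "earlier (Suc i) w = earlier i w"
          using u ru by (auto simp: earlier_def less_Suc_eq)
        then show ?thesis using old w'(3) False by (simp add: B'_def)
      qed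
    next
      have "total_density R E (rest (Suc i)) B' \<le> l * total_density R E (rest (Suc i)) B"
      proof (rule total_density_shrink[OF finr NV(1) sym(1) _ l])
        \<comment> \<open>Two adjacent neighbours of \<open>u\<close> would form a triangle with
          it.\<close>
        show "{v, w} \<notin> E" if "v \<in> N" "w \<in> N" for v w
        proof
          assume "{v, w} \<in> E"
          moreover have "{u, v} \<in> E" "{u, w} \<in> E" "v \<in> V" "w \<in> V"
            using that NV by (auto simp: N_def)
          ultimately show False using tf u(1) unfolding triangle_free_def by blast
        qed
        show "B' z = B z" if "z \<in> rest (Suc i) - N" for z
          using that rest_Suc by (auto simp: B'_def)
        show "weight R E (rest (Suc i) - N) B w y
            \<le> l * ((\<Sum>y\<in>B w. weight R E (rest (Suc i) - N) B w y) / card (B w))"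
          if "w \<in> N" "y \<in> B' w" for w y
        proof -
          have "w \<noteq> u" using uN that by auto
          then have "y \<in> Y w" using that by (simp add: B'_def)
          then show ?thesis by (simp add: Y_def \<phi>_def Z_def)
        qed
      qed
      also have "\<dots> \<le> l * total_density R E (rest i) B"
        using l total_density_mono[OF finr NV(2)] by (intro mult_left_mono) auto
      also have "\<dots> \<le> l * (l ^ i * s)"
        using l st unfolding state_def by (intro mult_left_mono) auto
      finally show "total_density R E (rest (Suc i)) B' \<le> l ^ Suc i * s" by (simp add: mult_ac)
    qed
    then show ?case by blast
  qed
  then obtain B where B: "state n B" by blast
  have rn: "r v < n" if "v \<in> V" for v using r(1) that bij_betwE by blast
  \<comment> \<open>Any choice works: by now the invariant relates all pairs of candidates of
    adjacent vertices.\<close>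
  define f where "f v = (SOME x. x \<in> B v)" for v
  have f: "f v \<in> B v" if "v \<in> V" for v
    using B rn[OF that] that unfolding state_def f_def by (metis some_in_eq)
  show ?copy
    using B f rn unfolding state_def by (intro exI[of _ f]) blast
qed

section \<open>Sparse pairs and tuples\<close>

text \<open>\<open>g\<close> measures the loss in size and \<open>t\<close> the density. Quantifying
  over all \<open>M\<close> and \<open>S\<close> allows repeated use inside sets already found. If
  all colours are below \<open>k\<close>, the case \<open>M = 1\<close> in a large enough set forces
  \<open>1 \<le> t\<close>.\<close>

definition sparse_pairs :: "(nat set \<Rightarrow> nat) \<Rightarrow> nat \<Rightarrow> nat \<Rightarrow> nat \<Rightarrow> real \<Rightarrow> bool" where
  "sparse_pairs c N k g t \<longleftrightarrow> (\<forall>M S. S \<subseteq> {..<N} \<and> g * M \<le> card S \<longrightarrow>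
     (\<exists>X Y. X \<subseteq> S \<and> Y \<subseteq> S \<and> card X = M \<and> card Y = M \<and> (\<forall>x\<in>X. \<forall>y\<in>Y. x < y) \<and>
       edges_between (\<lambda>x y. c {x, y} < k) X Y \<le> t * M\<^sup>2))"

definition sparse_tuples :: "(nat set \<Rightarrow> nat) \<Rightarrow> nat \<Rightarrow> nat \<Rightarrow> nat \<Rightarrow> nat \<Rightarrow> real \<Rightarrow> bool" where
  "sparse_tuples c N k r f t \<longleftrightarrow> (\<forall>m S. S \<subseteq> {..<N} \<and> f * m \<le> card S \<longrightarrow>
     (\<exists>U. (\<forall>i<r. U i \<subseteq> S \<and> card (U i) = m) \<and>
       (\<forall>i<r. \<forall>j<r. i < j \<longrightarrow> (\<forall>x\<in>U i. \<forall>y\<in>U j. x < y) \<and>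
         edges_between (\<lambda>x y. c {x, y} < k) (U i) (U j) \<le> t * m\<^sup>2)))"

lemma sparse_tuplesE:
  assumes "sparse_tuples c N k r f t" "S \<subseteq> {..<N}" "f * m \<le> card S"
  obtains U where "\<forall>i<r. U i \<subseteq> S \<and> card (U i) = m"
    "\<forall>i<r. \<forall>j<r. i < j \<longrightarrow> (\<forall>x\<in>U i. \<forall>y\<in>U j. x < y) \<and>
      edges_between (\<lambda>x y. c {x, y} < k) (U i) (U j) \<le> t * m\<^sup>2"
proof -
  have "\<exists>U. (\<forall>i<r. U i \<subseteq> S \<and> card (U i) = m) \<and>
      (\<forall>i<r. \<forall>j<r. i < j \<longrightarrow> (\<forall>x\<in>U i. \<forall>y\<in>U j. x < y) \<and>
        edges_between (\<lambda>x y. c {x, y} < k) (U i) (U j) \<le> t * m\<^sup>2)"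
    using assms(1)[unfolded sparse_tuples_def, rule_format, of S m] assms(2,3) by simp
  then show thesis using that by (elim exE conjE)
qed

lemma sparse_pairs_mono:
  assumes "sparse_pairs c N k g t" "g \<le> g'" "t \<le> t'"
  shows "sparse_pairs c N k g' t'"
  unfolding sparse_pairs_def
proof (intro allI impI)
  fix M S assume S: "S \<subseteq> {..<N} \<and> g' * M \<le> card S"
  then have "g * M \<le> card S" using assms(2) by (meson le_trans mult_le_mono1)
  then obtain X Y where XY: "X \<subseteq> S" "Y \<subseteq> S" "card X = M" "card Y = M" "\<forall>x\<in>X. \<forall>y\<in>Y. x < y"
      "edges_between (\<lambda>x y. c {x, y} < k) X Y \<le> t * M\<^sup>2"
    using assms(1) S unfolding sparse_pairs_def by meson
  have "t * M\<^sup>2 \<le> t' * M\<^sup>2" using assms(3) by (simp add: mult_right_mono)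
  then show "\<exists>X Y. X \<subseteq> S \<and> Y \<subseteq> S \<and> card X = M \<and> card Y = M \<and> (\<forall>x\<in>X. \<forall>y\<in>Y. x < y) \<and>
      edges_between (\<lambda>x y. c {x, y} < k) X Y \<le> t' * M\<^sup>2"
    using XY by (intro exI[of _ X] exI[of _ Y]) auto
qed

lemma sparse_tuples_mono:
  assumes "sparse_tuples c N k r f t" "r' \<le> r" "t \<le> t'"
  shows "sparse_tuples c N k r' f t'"
  unfolding sparse_tuples_def
proof (intro allI impI)
  fix m S assume S: "S \<subseteq> {..<N} \<and> f * m \<le> card S"
  then obtain U where U: "\<forall>i<r. U i \<subseteq> S \<and> card (U i) = m"
      "\<forall>i<r. \<forall>j<r. i < j \<longrightarrow> (\<forall>x\<in>U i. \<forall>y\<in>U j. x < y) \<and>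
         edges_between (\<lambda>x y. c {x, y} < k) (U i) (U j) \<le> t * m\<^sup>2"
    using S by (elim conjE sparse_tuplesE[OF assms(1)])
  have tm: "t * m\<^sup>2 \<le> t' * m\<^sup>2" using assms(3) by (simp add: mult_right_mono)
  have "(\<forall>x\<in>U i. \<forall>y\<in>U j. x < y) \<and>
      edges_between (\<lambda>x y. c {x, y} < k) (U i) (U j) \<le> t' * m\<^sup>2" if "i < r'" "j < r'" "i < j" for i j
  proof -
    have "i < r" "j < r" using that assms(2) by auto
    then have "(\<forall>x\<in>U i. \<forall>y\<in>U j. x < y) \<and>
        edges_between (\<lambda>x y. c {x, y} < k) (U i) (U j) \<le> t * m\<^sup>2"
      using U(2) that(3) by blast
    then show ?thesis using tm order_trans by blast
  qed
  moreover have "U i \<subseteq> S \<and> card (U i) = m" if "i < r'" for i using U(1) that assms(2) by simp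
  ultimately show "\<exists>U. (\<forall>i<r'. U i \<subseteq> S \<and> card (U i) = m) \<and>
      (\<forall>i<r'. \<forall>j<r'. i < j \<longrightarrow> (\<forall>x\<in>U i. \<forall>y\<in>U j. x < y) \<and>
         edges_between (\<lambda>x y. c {x, y} < k) (U i) (U j) \<le> t' * m\<^sup>2)"
    by (intro exI[of _ U]) blast
qed

text \<open>No colour is below 0, so consecutive blocks suffice. This start is why the first colour
  costs no factor \<open>L\<close> in the exponent.\<close>

lemma sparse_tuples_0:
  assumes "0 \<le> t"
  shows "sparse_tuples c N 0 r r t"
  unfolding sparse_tuples_def
proof (intro allI impI)
  fix m S assume S: "S \<subseteq> {..<N} \<and> r * m \<le> card S"
  then have "finite S" using finite_subset by blast
  then obtain U where "(\<forall>i<r. U i \<subseteq> S \<and> card (U i) = m) \<and>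
      (\<forall>i<r. \<forall>j<r. i < j \<longrightarrow> (\<forall>x\<in>U i. \<forall>y\<in>U j. x < y))"
    using consecutive_blocks[of S r m] S by blast
  moreover have "edges_between (\<lambda>x y. c {x, y} < 0) A B \<le> t * m\<^sup>2" for A B
    using assms by (simp add: edges_between_def)
  ultimately show "\<exists>U. (\<forall>i<r. U i \<subseteq> S \<and> card (U i) = m) \<and>
      (\<forall>i<r. \<forall>j<r. i < j \<longrightarrow> (\<forall>x\<in>U i. \<forall>y\<in>U j. x < y) \<and>
         edges_between (\<lambda>x y. c {x, y} < 0) (U i) (U j) \<le> t * m\<^sup>2)"
    by (intro exI[of _ U]) blast
qed

text \<open>One tuple is found on each side of a sparse pair. The right side is cleaned only after
  the left tuple is fixed, and against its union \<open>Z\<close>, so that every remaining vertex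
  has few edges to all left sets at once. The density inside each tuple is not affected.\<close>

lemma sparse_tuples_double:
  assumes pairs: "sparse_pairs c N k g t" and t: "0 \<le> t"
    and tuples: "sparse_tuples c N k r f s" and s: "4 * r * t \<le> s"
  shows "sparse_tuples c N k (2 * r) (2 * g * f) s"
  unfolding sparse_tuples_def
proof (intro allI impI)
  fix m S assume S: "S \<subseteq> {..<N} \<and> 2 * g * f * m \<le> card S"
  let ?R = "\<lambda>x y. c {x, y} < k"
  \<comment> \<open>The factor 2 pays for dropping the vertices above twice the mean, which leaves
    the \<open>f * m\<close> needed for a tuple.\<close>
  define M where "M = 2 * (f * m)"
  have "g * M \<le> card S" using S by (simp add: M_def mult_ac)
  then obtain X Y where XY: "X \<subseteq> S" "Y \<subseteq> S" "card X = M" "card Y = M" "\<forall>x\<in>X. \<forall>y\<in>Y. x < y"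
      and e: "edges_between ?R X Y \<le> t * M\<^sup>2"
    using pairs S unfolding sparse_pairs_def by meson
  have fin: "finite X" "finite Y" using XY(1,2) S by (meson finite_lessThan finite_subset)+
  have half: "f * m \<le> card A" if "(1 - 1 / 2) * real M \<le> real (card A)" for A :: "nat set"
    using that by (simp add: M_def flip: of_nat_mult)
  let ?X = "{x \<in> X. edges_between ?R {x} Y \<le> 2 * (edges_between ?R X Y / M)}"
  have bigX: "f * m \<le> card ?X"
    unfolding XY(3)[symmetric] edges_between_sum_left[of ?R X Y]
    by (intro half[unfolded XY(3)[symmetric]] card_le_multiple_of_mean fin edges_between_nonneg) simp
  have subX: "?X \<subseteq> {..<N}" using XY(1) S by auto
  obtain U where U: "\<forall>i<r. U i \<subseteq> ?X \<and> card (U i) = m"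
      "\<forall>i<r. \<forall>j<r. i < j \<longrightarrow> (\<forall>x\<in>U i. \<forall>y\<in>U j. x < y) \<and> edges_between ?R (U i) (U j) \<le> s * m\<^sup>2"
    by (rule sparse_tuplesE[OF tuples subX bigX])
  define Z where "Z = (\<Union>i<r. U i)"
  have ZX: "Z \<subseteq> ?X" using U(1) by (auto simp: Z_def)
  have finZ: "finite Z" by (rule finite_subset[OF ZX]) (simp add: fin)
  have "card Z \<le> (\<Sum>i<r. card (U i))" unfolding Z_def by (rule card_UN_le) simp
  also have "\<dots> = r * m" using U(1) by simp
  finally have cardZ: "card Z \<le> r * m" .
  have "edges_between ?R {x} Y \<le> 2 * t * M" if "x \<in> Z" for x
  proof -
    have "edges_between ?R X Y / M \<le> t * M"
      using e by (cases "M = 0") (auto simp: power2_eq_square divide_le_eq)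
    then show ?thesis using that ZX by auto
  qed
  then have "edges_between ?R Z Y \<le> card Z * (2 * t * M)"
    by (subst edges_between_sum_left) (rule sum_bounded_above)
  also have "\<dots> \<le> real (r * m) * (2 * t * M)"
    using cardZ t by (intro mult_right_mono) (simp_all flip: of_nat_mult)
  finally have eZ: "edges_between ?R Z Y / M \<le> 2 * r * t * m"
    by (cases "M = 0") (auto simp: divide_le_eq t mult_ac)
  let ?Y = "{y \<in> Y. edges_between ?R Z {y} \<le> 2 * (edges_between ?R Z Y / M)}"
  have bigY: "f * m \<le> card ?Y"
    unfolding XY(4)[symmetric] edges_between_sum_right[of ?R Z Y]
    by (intro half[unfolded XY(4)[symmetric]] card_le_multiple_of_mean fin edges_between_nonneg) simp
  have subY: "?Y \<subseteq> {..<N}" using XY(2) S by auto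
  obtain U' where U': "\<forall>i<r. U' i \<subseteq> ?Y \<and> card (U' i) = m"
      "\<forall>i<r. \<forall>j<r. i < j \<longrightarrow> (\<forall>x\<in>U' i. \<forall>y\<in>U' j. x < y) \<and> edges_between ?R (U' i) (U' j) \<le> s * m\<^sup>2"
    by (rule sparse_tuplesE[OF tuples subY bigY])
  have cross: "edges_between ?R (U i) (U' j) \<le> s * m\<^sup>2" if "i < r" "j < r" for i j
  proof -
    have subU': "U' j \<subseteq> ?Y" using U'(1) that(2) by blast
    have finU': "finite (U' j)" by (rule finite_subset[OF subU']) (simp add: fin)
    have "edges_between ?R (U i) (U' j) \<le> edges_between ?R Z (U' j)"
      using that(1) finZ finU' by (intro edges_between_mono) (auto simp: Z_def)
    \<comment> \<open>One factor 2 comes from cleaning \<open>X\<close>, the other from cleaning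
      \<open>Y\<close>; \<open>r * m\<close> bounds the size of \<open>Z\<close>.\<close>
    also have "\<dots> \<le> card (U' j) * (4 * r * t * m)"
    proof (subst edges_between_sum_right, rule sum_bounded_above)
      fix y assume "y \<in> U' j"
      then have "edges_between ?R Z {y} \<le> 2 * (edges_between ?R Z Y / M)" using U'(1) that(2) by blast
      then show "edges_between ?R Z {y} \<le> 4 * r * t * m" using eZ by simp
    qed
    also have "\<dots> = 4 * r * t * m\<^sup>2" using U'(1) that(2) by (simp add: power2_eq_square)
    also have "\<dots> \<le> s * m\<^sup>2" using s by (intro mult_right_mono) auto
    finally show ?thesis .
  qed
  define T where "T i = (if i < r then U i else U' (i - r))" for i
  have "T i \<subseteq> S \<and> card (T i) = m" if "i < 2 * r" for i
  proof (cases "i < r")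
    case True
    then have "U i \<subseteq> X \<and> card (U i) = m" using U(1) by blast
    then show ?thesis using XY(1) True unfolding T_def by auto
  next
    case False
    then have "i - r < r" using that by simp
    then have "U' (i - r) \<subseteq> Y \<and> card (U' (i - r)) = m" using U'(1) by blast
    then show ?thesis using XY(2) False unfolding T_def by auto
  qed
  moreover have "(\<forall>x\<in>T i. \<forall>y\<in>T j. x < y) \<and> edges_between ?R (T i) (T j) \<le> s * m\<^sup>2"
    if ij: "i < 2 * r" "j < 2 * r" "i < j" for i j
  proof -
    consider "j < r" | "i < r" "r \<le> j" | "r \<le> i" by linarith
    then show ?thesis
    proof cases
      case 1
      then have T: "T i = U i" "T j = U j" "i < r" using ij by (auto simp: T_def)
      show ?thesis unfolding T(1,2) using U(2) T(3) 1 ij(3) by blast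
    next
      case 2
      then have jr: "j - r < r" using ij by simp
      then have "U i \<subseteq> X" "U' (j - r) \<subseteq> Y" using U(1) U'(1) 2 by auto
      then show ?thesis using cross[OF 2(1) jr] XY(5) 2 by (auto simp: T_def)
    next
      case 3
      then have "i - r < r" "j - r < r" "i - r < j - r" using ij by auto
      moreover have T: "T i = U' (i - r)" "T j = U' (j - r)" using 3 ij by (auto simp: T_def)
      ultimately show ?thesis unfolding T using U'(2) by blast
    qed
  qed
  ultimately show "\<exists>U. (\<forall>i<2 * r. U i \<subseteq> S \<and> card (U i) = m) \<and>
      (\<forall>i<2 * r. \<forall>j<2 * r. i < j \<longrightarrow> (\<forall>x\<in>U i. \<forall>y\<in>U j. x < y) \<and>
        edges_between ?R (U i) (U j) \<le> s * m\<^sup>2)" by blast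
qed

text \<open>The density bound is the one demanded by the last doubling, \<open>4 * 2 ^ h * t\<close>
  when going from \<open>2 ^ h\<close> to \<open>2 ^ Suc h\<close> sets; the shorter tuples are
  sparser than that.\<close>

lemma sparse_tuples_power:
  assumes "sparse_pairs c N k g t" and t: "0 \<le> t"
  shows "sparse_tuples c N k (2 ^ h) ((2 * g) ^ h) (2 * 2 ^ h * t)"
proof (induction h)
  case 0
  show ?case
    unfolding sparse_tuples_def
  proof (intro allI impI)
    fix m S assume "S \<subseteq> {..<N} \<and> (2 * g) ^ 0 * m \<le> card S"
    then obtain T where "T \<subseteq> S" "card T = m"
      by (metis mult_1 obtain_subset_with_card_n power_0)
    then show "\<exists>U :: nat \<Rightarrow> nat set. (\<forall>i<2 ^ 0. U i \<subseteq> S \<and> card (U i) = m) \<and>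
      (\<forall>i<2 ^ 0. \<forall>j<2 ^ 0. i < j \<longrightarrow> (\<forall>x\<in>U i. \<forall>y\<in>U j. x < y) \<and>
        edges_between (\<lambda>x y. c {x, y} < k) (U i) (U j) \<le> 2 * 2 ^ 0 * t * m\<^sup>2)"
      by (intro exI[of _ "\<lambda>_. T"]) auto
  qed
next
  case (Suc h)
  have "sparse_tuples c N k (2 ^ h) ((2 * g) ^ h) (2 * 2 ^ Suc h * t)"
    using t by (intro sparse_tuples_mono[OF Suc]) auto
  then show ?case
    using sparse_tuples_double[OF assms, of "2 ^ h" "(2 * g) ^ h" "2 * 2 ^ Suc h * t"]
    by (simp add: mult_ac)
qed

section \<open>Adding one more colour\<close>

lemma edges_between_Suc:
  "edges_between (\<lambda>x y. c {x, y} < Suc k) X Y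
    = edges_between (\<lambda>x y. c {x, y} < k) X Y + edges_between (\<lambda>x y. c {x, y} = k) X Y"
  unfolding edges_between_def by (simp add: less_Suc_eq_le le_less of_bool_def flip: sum.distrib)
    (intro sum.cong refl, auto)

text \<open>Vertex \<open>v\<close> gets its own block in the set of the tuple belonging to its
  interval. The blocks are ordered like \<open>V\<close>, so any choice of images is increasing, and
  edges of \<open>H\<close> join blocks from different, hence mutually sparse, sets of the
  tuple.\<close>

lemma sparse_pairs_Suc:
  fixes V :: "'a::linorder set" and n d f a k :: nat and t :: real
  assumes G: "ordered_graph V E" "card V = n" "0 < n" "degenerate d V E" "triangle_free V E"
    and p: "\<And>v. v \<in> V \<Longrightarrow> p v < r" "mono_on V p"
      "\<And>u v. u \<in> V \<Longrightarrow> v \<in> V \<Longrightarrow> {u, v} \<in> E \<Longrightarrow> p u \<noteq> p v"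
    and tuples: "sparse_tuples c N k r f t" and t: "0 \<le> t" and a: "0 < a"
    and no_copy: "\<not> (\<exists>f. ordered_copy f V E {..<N} ([{..<N}]\<^bsup>2\<^esup>) \<and>
        (\<forall>u\<in>V. \<forall>v\<in>V. {u, v} \<in> E \<longrightarrow> c {f u, f v} = k))"
  shows "sparse_pairs c N (Suc k) (f * n * (n + 1) * (a * (n + 1)) ^ d)
    (3 * real n * real (n + 1) * (real n ^ 4 * t) + 1 / a)"
  unfolding sparse_pairs_def
proof (intro allI impI)
  fix M S assume S: "S \<subseteq> {..<N} \<and> f * n * (n + 1) * (a * (n + 1)) ^ d * M \<le> card S"
  let ?R = "\<lambda>x y. c {x, y} < k" and ?Q = "\<lambda>x y. c {x, y} = k"
  let ?t = "3 * real n * real (n + 1) * (real n ^ 4 * t) + 1 / a"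
  show "\<exists>X Y. X \<subseteq> S \<and> Y \<subseteq> S \<and> card X = M \<and> card Y = M \<and> (\<forall>x\<in>X. \<forall>y\<in>Y. x < y) \<and>
      edges_between (\<lambda>x y. c {x, y} < Suc k) X Y \<le> ?t * M\<^sup>2"
  proof (cases "M = 0")
    case True
    then show ?thesis by (intro exI[of _ "{}"]) (auto simp: edges_between_def)
  next
    case False
    have fin: "finite V" and EV: "E \<subseteq> [V]\<^bsup>2\<^esup>" using G(1) by (auto simp: ordered_graph_def)
    have sym: "symp ?R" "symp ?Q" by (auto simp: symp_def insert_commute)
    \<comment> \<open>The candidate set size required by the embedding; each set of the tuple has
      room for \<open>n\<close> such blocks.\<close>
    define m where "m = (a * (n + 1)) ^ d * ((n + 1) * M)"
    have M: "0 < M" and m: "0 < m" using a False by (simp_all add: m_def)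
    have big: "f * (n * m) \<le> card S" using S unfolding m_def by (simp only: mult_ac)
    have "S \<subseteq> {..<N}" using S by simp
    then obtain U where U: "\<forall>i<r. U i \<subseteq> S \<and> card (U i) = n * m"
      "\<forall>i<r. \<forall>j<r. i < j \<longrightarrow> (\<forall>x\<in>U i. \<forall>y\<in>U j. x < y) \<and>
        edges_between ?R (U i) (U j) \<le> t * (n * m)\<^sup>2"
      using big by (rule sparse_tuplesE[OF tuples])
    have finU: "finite (U i)" if "i < r" for i
      using U(1) S that by (meson finite_lessThan finite_subset)
    have "\<forall>i\<in>{..<r}. \<exists>g. (\<forall>j<n. g j \<subseteq> U i \<and> card (g j) = m) \<and>
        (\<forall>j<n. \<forall>j'<n. j < j' \<longrightarrow> (\<forall>x\<in>g j. \<forall>y\<in>g j'. x < y))"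
      using U(1) finU by (intro ballI consecutive_blocks) auto
    then obtain B where B: "\<And>i j. i < r \<Longrightarrow> j < n \<Longrightarrow> B i j \<subseteq> U i \<and> card (B i j) = m"
      "\<And>i j j' x y. i < r \<Longrightarrow> j < n \<Longrightarrow> j' < n \<Longrightarrow> j < j' \<Longrightarrow> x \<in> B i j \<Longrightarrow> y \<in> B i j' \<Longrightarrow> x < y"
      unfolding bchoice_iff by (metis lessThan_iff)
    define \<rho> where "\<rho> v = card {w \<in> V. w < v}" for v
    have \<rho>: "\<rho> v < n" if "v \<in> V" for v
      unfolding \<rho>_def G(2)[symmetric] using that fin by (intro psubset_card_mono) auto
    have \<rho>_less: "\<rho> v < \<rho> w" if "v \<in> V" "v < w" for v w
      unfolding \<rho>_def using that fin by (intro psubset_card_mono) auto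
    define W where "W v = B (p v) (\<rho> v)" for v
    have W: "W v \<subseteq> U (p v)" "card (W v) = m" "finite (W v)" "W v \<subseteq> S" if "v \<in> V" for v
    proof -
      show sub: "W v \<subseteq> U (p v)" and "card (W v) = m"
        using B(1)[OF p(1)[OF that] \<rho>[OF that]] by (auto simp: W_def)
      show "finite (W v)" "W v \<subseteq> S"
        using sub finU[OF p(1)[OF that]] U(1) p(1)[OF that] finite_subset by blast+
    qed
    have W_less: "x < y" if "v \<in> V" "w \<in> V" "v < w" "x \<in> W v" "y \<in> W w" for v w x y
    proof (cases "p v = p w")
      case True
      then show ?thesis
        using B(2)[OF p(1) \<rho> \<rho> \<rho>_less] that unfolding W_def by metis
    next
      case False
      then have "p v < p w" using p(2) that by (metis less_imp_le mono_onD order_less_le)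
      then show ?thesis using U(2) p(1) W(1) that by blast
    qed
    \<comment> \<open>Both sides shrink from \<open>n * m\<close> to \<open>m\<close>, so the
      density grows by at most \<open>n ^ 2\<close>. Summing over \<open>n ^ 2\<close> ordered pairs
      then gives the \<open>n ^ 4\<close> below.\<close>
    have dens: "density ?R (W v) (W w) \<le> n\<^sup>2 * t" if vw: "v \<in> V" "w \<in> V" "{v, w} \<in> E" for v w
    proof -
      have "edges_between ?R (U (p v)) (U (p w)) \<le> t * (n * m)\<^sup>2"
      proof (cases "p v < p w")
        case True
        then show ?thesis using U(2) p(1)[OF vw(1)] p(1)[OF vw(2)] by blast
      next
        case False
        then have "p w < p v" using p(3)[OF vw] by simp
        then have "edges_between ?R (U (p w)) (U (p v)) \<le> t * (n * m)\<^sup>2"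
          using U(2) p(1)[OF vw(1)] p(1)[OF vw(2)] by blast
        then show ?thesis by (simp only: edges_between_sym[OF sym(1), of "U (p v)"])
      qed
      then have "edges_between ?R (W v) (W w) \<le> t * (n * m)\<^sup>2"
        using edges_between_mono[OF finU[OF p(1)[OF vw(1)]] finU[OF p(1)[OF vw(2)]] W(1)[OF vw(1)] W(1)[OF vw(2)]]
        order_trans by blast
      then show ?thesis
        using m unfolding density_def W(2)[OF vw(1)] W(2)[OF vw(2)]
        by (simp add: divide_le_eq power2_eq_square mult_ac)
    qed
    have "total_density ?R E V W \<le> (\<Sum>v\<in>V. \<Sum>w\<in>V. n\<^sup>2 * t)"
      unfolding total_density_def using dens t by (intro sum_mono) auto
    also have "\<dots> = real n ^ 4 * t" by (simp add: G(2) power2_eq_square power4_eq_xxxx mult_ac)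
    finally have total: "total_density ?R E V W \<le> real n ^ 4 * t" .
    have large: "(a * (n + 1)) ^ d * ((n + 1) * M) \<le> card (W v)" if "v \<in> V" for v
      using W(2)[OF that] by (simp add: m_def)
    consider (copy) h where "\<forall>v\<in>V. h v \<in> W v" "\<forall>u\<in>V. \<forall>v\<in>V. {u, v} \<in> E \<longrightarrow> ?Q (h u) (h v)"
      | (sparse) u w X Y where "u \<in> V" "w \<in> V" "{u, w} \<in> E" "X \<subseteq> W u" "Y \<subseteq> W w"
        "M \<le> card X" "M \<le> card Y"
        "edges_between ?R X Y \<le> 3 * real n * real (n + 1) * (real n ^ 4 * t) * real (card X * card Y)"
        "edges_between ?Q X Y \<le> 1 / real a * real (card X * card Y)"
      by (rule disjE[OF embedding_or_sparse_pair[OF fin G(2,3) EV G(5,4) sym W(3) large a M total]])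
        blast+
    then show ?thesis
    proof cases
      case copy
      have mono: "h u < h v" if "u \<in> V" "v \<in> V" "u < v" for u v
        using W_less that copy(1) by blast
      have sub: "h v < N" if "v \<in> V" for v
        using copy(1) W(4)[OF that] S that by blast
      have "h u \<noteq> h v" if "u \<in> V" "v \<in> V" "{u, v} \<in> E" for u v
      proof -
        have "u \<noteq> v" using that EV by (auto simp: nsets_def)
        then show ?thesis using mono that by (metis less_irrefl linorder_neqE)
      qed
      then have "ordered_copy h V E {..<N} ([{..<N}]\<^bsup>2\<^esup>)"
        unfolding ordered_copy_def using mono sub by (auto intro!: strict_mono_onI)
      then show ?thesis using no_copy copy(2) by blast
    next
      case sparse
      have finXY: "finite X" "finite Y" using sparse W(3) finite_subset by blast+
      have "edges_between (\<lambda>x y. c {x, y} < Suc k) X Y \<le> ?t * (card X * card Y)"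
        using sparse(8,9) unfolding edges_between_Suc by (simp add: distrib_right)
      then obtain X' Y' where XY: "X' \<subseteq> X" "Y' \<subseteq> Y" "card X' = M" "card Y' = M"
          "edges_between (\<lambda>x y. c {x, y} < Suc k) X' Y' \<le> ?t * M\<^sup>2"
        using edges_between_trim[OF finXY sparse(6,7)] by blast
      have sub: "X' \<subseteq> W u" "Y' \<subseteq> W w" "X' \<subseteq> S" "Y' \<subseteq> S"
        using XY(1,2) sparse W(4) by blast+
      have sym': "symp (\<lambda>x y. c {x, y} < Suc k)" by (auto simp: symp_def insert_commute)
      have "u \<noteq> w" using sparse(3) EV by (auto simp: nsets_def)
      \<comment> \<open>The stuck edge may point either way, and \<open>sparse_pairs\<close> wants
        the left set first.\<close>
      then consider "u < w" | "w < u" by fastforce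
      then show ?thesis
      proof cases
        case 1
        then have "\<forall>x\<in>X'. \<forall>y\<in>Y'. x < y" using W_less sparse(1,2) sub by blast
        then show ?thesis using XY sub by blast
      next
        case 2
        then have "\<forall>x\<in>Y'. \<forall>y\<in>X'. x < y" using W_less sparse(1,2) sub by blast
        moreover have "edges_between (\<lambda>x y. c {x, y} < Suc k) Y' X' \<le> ?t * M\<^sup>2"
          using XY(5) edges_between_sym[OF sym'] by metis
        ultimately show ?thesis using XY(3,4) sub by blast
      qed
    qed
  qed
qed

section \<open>Choice of parameters and conclusion\<close>

lemma ceiling_log2_bounds:
  assumes "2 \<le> x" and L_def: "L = nat \<lceil>log 2 (real x)\<rceil>"
  shows "1 \<le> L" "x \<le> 2 ^ L" "2 ^ L \<le> 2 * x"
proof -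
  have log: "1 \<le> log 2 (real x)" using assms(1) by (simp add: le_log_iff)
  then show "1 \<le> L" unfolding L_def by linarith
  have "log 2 (real x) \<le> L" using log unfolding L_def by linarith
  then have "real x \<le> 2 powr L" using assms(1) by (simp add: log_le_iff)
  then have "real x \<le> real (2 ^ L)" by (simp add: powr_realpow)
  then show "x \<le> 2 ^ L" by (simp only: of_nat_le_iff)
  have "real L \<le> log 2 (real x) + 1" using log unfolding L_def by linarith
  then have "real L \<le> log 2 (2 * real x)" using assms(1) by (simp add: log_mult)
  then have "2 powr L \<le> 2 * real x" using assms(1) by (simp add: le_log_iff)
  then have "real (2 ^ L) \<le> real (2 * x)" by (simp add: powr_realpow)
  then show "2 ^ L \<le> 2 * x" by (simp only: of_nat_le_iff)
qed

text \<open>In the proof, \<open>1 / a\<close> is the density below which the embedding counts as stuck, and the density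
  bound grows by a factor \<open>n ^ 13\<close> per colour. Since \<open>a\<close> does not depend on \<open>d\<close>, the exponent is
  linear in \<open>d\<close>.\<close>

lemma sparse_pairs_all_colours:
  fixes V :: "'a::linorder set" and n d q k \<chi> L C :: nat
  assumes G: "ordered_graph V E" "card V = n" "2 \<le> n" "degenerate d V E" "triangle_free V E"
    and \<chi>: "interval_chromatic_number V E = \<chi>" and L: "1 \<le> L" "\<chi> \<le> 2 ^ L" "2 ^ L \<le> 2 * \<chi>"
    and no_copy: "\<And>i. i < q \<Longrightarrow> \<not> (\<exists>f. ordered_copy f V E {..<N} ([{..<N}]\<^bsup>2\<^esup>) \<and>
        (\<forall>u\<in>V. \<forall>v\<in>V. {u, v} \<in> E \<longrightarrow> c {f u, f v} = i))"
    and C: "C = 4 + d * (13 * q + 3)"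
    and k: "k < q"
  shows "sparse_pairs c N (Suc k) (n ^ (Suc k * C * L ^ k)) (real n ^ (13 * Suc k) / real n ^ (13 * q + 1))"
proof -
  define a where "a = n ^ (13 * q + 1)"
  \<comment> \<open>Starts at \<open>1 / a\<close> and reaches \<open>1 / n < 1\<close> at
    \<open>k = q\<close>.\<close>
  define \<epsilon> where "\<epsilon> k = real n ^ (13 * k) / real n ^ (13 * q + 1)" for k
  have a: "0 < a" using G(3) by (simp add: a_def)
  have \<epsilon>: "0 \<le> \<epsilon> k" for k by (simp add: \<epsilon>_def)
  have \<chi>_n: "\<chi> \<le> n" using interval_chromatic_number_le_card[OF G(1)] G(2) \<chi> by simp
  obtain p where p: "\<forall>v\<in>V. p v < \<chi>" "mono_on V p" "\<forall>u\<in>V. \<forall>v\<in>V. {u, v} \<in> E \<longrightarrow> p u \<noteq> p v"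
    using interval_chromatic_number_colouring[OF G(1)] \<chi> by auto
  have "2 * n \<le> n * n" using G(3) by (rule mult_le_mono1)
  then have n_le: "n + 1 \<le> n ^ 2" "2 \<le> n"
    using G(3) unfolding power2_eq_square by linarith+
  have size: "n * (n + 1) * (a * (n + 1)) ^ d \<le> n ^ (3 + d * (13 * q + 3))"
  proof -
    have "n * (n + 1) \<le> n * n ^ 2" using n_le by (intro mult_le_mono2)
    moreover have "a * (n + 1) \<le> n ^ (13 * q + 1) * n ^ 2" using n_le unfolding a_def by (intro mult_le_mono2)
    then have "(a * (n + 1)) ^ d \<le> (n ^ (13 * q + 3)) ^ d"
      by (intro power_mono) (simp_all add: power_add eval_nat_numeral mult_ac)
    ultimately have "n * (n + 1) * (a * (n + 1)) ^ d \<le> n * n ^ 2 * (n ^ (13 * q + 3)) ^ d"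
      by (rule mult_le_mono)
    also have "\<dots> = n ^ (3 + d * (13 * q + 3))"
      by (simp add: power_add power_mult mult.commute[of d] power3_eq_cube power2_eq_square)
    finally show ?thesis .
  qed
  \<comment> \<open>The factor \<open>4 * n\<close> bounds \<open>2 * 2 ^ L\<close>, the loss from
    building tuples. As \<open>12 \<le> n ^ 4\<close> and \<open>n + 1 \<le> n ^ 2\<close>, the
    first term costs at most \<open>n ^ 12\<close>; one more factor \<open>n\<close> absorbs
    \<open>1 / a\<close>.\<close>
  have error: "3 * real n * real (n + 1) * (real n ^ 4 * (4 * n * \<epsilon> k)) + 1 / a \<le> \<epsilon> (Suc k)" for k
  proof -
    let ?n = "real n"
    have n2: "2 \<le> ?n" using G(3) by simp
    have "12 \<le> ?n ^ 4" using power_mono[OF n2, of 4] by simp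
    moreover have "?n + 1 \<le> ?n ^ 2" using n_le(1) by (metis of_nat_1 of_nat_add of_nat_le_iff of_nat_power)
    ultimately have "12 * (?n + 1) * ?n ^ 6 \<le> ?n ^ 4 * ?n ^ 2 * ?n ^ 6"
      using n2 by (intro mult_mono) auto
    then have A: "12 * (?n + 1) * ?n ^ 6 \<le> ?n ^ 12" by (simp flip: power_add)
    have "2 * ?n ^ 12 \<le> ?n * ?n ^ 12" using n2 by (intro mult_right_mono) auto
    moreover have "1 \<le> ?n ^ 12" using n2 by (intro one_le_power) auto
    ultimately have B: "12 * (?n + 1) * ?n ^ 6 + 1 \<le> ?n ^ 13" using A by (simp flip: power_Suc)
    have one: "1 \<le> ?n ^ (13 * k)" using n2 by (intro one_le_power) auto
    have "12 * (?n + 1) * ?n ^ 6 * ?n ^ (13 * k) + 1 \<le> (12 * (?n + 1) * ?n ^ 6 + 1) * ?n ^ (13 * k)"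
      using one by (simp add: distrib_right)
    also have "\<dots> \<le> ?n ^ 13 * ?n ^ (13 * k)" using B by (intro mult_right_mono) auto
    also have "\<dots> = ?n ^ (13 * Suc k)" by (simp add: power_add)
    finally have "(12 * (?n + 1) * ?n ^ 6 * ?n ^ (13 * k) + 1) / ?n ^ (13 * q + 1) \<le> \<epsilon> (Suc k)"
      unfolding \<epsilon>_def by (intro divide_right_mono) auto
    moreover have "3 * ?n * (?n + 1) * (?n ^ 4 * (4 * n * \<epsilon> k)) + 1 / a
        = (12 * (?n + 1) * ?n ^ 6 * ?n ^ (13 * k) + 1) / ?n ^ (13 * q + 1)"
      unfolding \<epsilon>_def a_def by (simp add: add_divide_distrib eval_nat_numeral)
    ultimately show ?thesis by (simp add: add.commute)
  qed
  have step: "sparse_pairs c N (Suc k) g (\<epsilon> (Suc k))"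
    if "sparse_tuples c N k \<chi> f (4 * n * \<epsilon> k)" "k < q" "f * n ^ (3 + d * (13 * q + 3)) \<le> g" for k f g
  proof -
    have "sparse_pairs c N (Suc k) (f * n * (n + 1) * (a * (n + 1)) ^ d)
        (3 * real n * real (n + 1) * (real n ^ 4 * (4 * n * \<epsilon> k)) + 1 / a)"
      using G(3) p \<epsilon>[of k] a no_copy[OF that(2)]
      by (intro sparse_pairs_Suc[OF G(1,2) _ G(4,5) _ _ _ that(1)]) auto
    moreover have "f * n * (n + 1) * (a * (n + 1)) ^ d \<le> g"
      using mult_le_mono2[OF size, of f] that(3) by (simp only: mult.assoc)
    ultimately show ?thesis using error sparse_pairs_mono by blast
  qed
  have "sparse_pairs c N (Suc k) (n ^ (Suc k * C * L ^ k)) (\<epsilon> (Suc k))"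
    using k
  proof (induction k)
    case 0
    \<comment> \<open>The \<open>\<chi> \<le> n\<close> blocks account for the 4 in place of 3 in
      \<open>C\<close>.\<close>
    have "\<chi> * n ^ (3 + d * (13 * q + 3)) \<le> n * n ^ (3 + d * (13 * q + 3))"
      using \<chi>_n by (rule mult_le_mono1)
    then show ?case
      using 0 \<epsilon>[of 0] by (intro step[OF sparse_tuples_0]) (auto simp: C simp flip: power_Suc)
  next
    case (Suc k)
    define e where "e = Suc k * C * L ^ k"
    define D where "D = 3 + d * (13 * q + 3)"
    have "sparse_tuples c N (Suc k) (2 ^ L) ((2 * n ^ e) ^ L) (2 * 2 ^ L * \<epsilon> (Suc k))"
      using Suc \<epsilon> unfolding e_def by (intro sparse_tuples_power) auto
    then have "sparse_tuples c N (Suc k) \<chi> ((2 * n ^ e) ^ L) (4 * n * \<epsilon> (Suc k))"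
    proof (rule sparse_tuples_mono[OF _ L(2)])
      have "2 * 2 ^ L \<le> 4 * n" using L(3) \<chi>_n by linarith
      then have "real (2 * 2 ^ L) \<le> real (4 * n)" by (simp only: of_nat_le_iff)
      then show "2 * 2 ^ L * \<epsilon> (Suc k) \<le> 4 * n * \<epsilon> (Suc k)"
        using \<epsilon> by (intro mult_right_mono) auto
    qed
    then show ?case
    proof (rule step)
      show "Suc k < q" by (rule Suc.prems)
      have "(2 * n ^ e) ^ L \<le> (n * n ^ e) ^ L"
        using n_le(2) by (intro power_mono mult_le_mono1) auto
      also have "\<dots> = n ^ ((e + 1) * L)" by (simp only: power_mult power_Suc flip: Suc_eq_plus1)
      finally have "(2 * n ^ e) ^ L * n ^ D \<le> n ^ ((e + 1) * L) * n ^ D"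
        by (rule mult_le_mono1)
      also have "\<dots> = n ^ ((e + 1) * L + D)" by (simp add: power_add)
      also have "\<dots> \<le> n ^ (Suc (Suc k) * C * L ^ Suc k)"
      proof (rule power_increasing)
        \<comment> \<open>With \<open>C = D + 1\<close>, the new costs \<open>L\<close> (for the
          factors 2 in the nesting) and \<open>D\<close> (for the embedding) fit into one more
          summand \<open>C * L ^ Suc k\<close>.\<close>
        have "L + D \<le> L * C"
        proof -
          have "D \<le> L * D" using L(1) by simp
          moreover have "L * C = L + L * D" by (simp add: C D_def algebra_simps)
          ultimately show ?thesis by simp
        qed
        also have "\<dots> \<le> L ^ Suc k * C"
          using L(1) self_le_power[of L "Suc k"] by (intro mult_le_mono1) simp
        finally show "(e + 1) * L + D \<le> Suc (Suc k) * C * L ^ Suc k"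
          by (simp add: e_def algebra_simps)
      qed (use n_le in simp)
      finally show "(2 * n ^ e) ^ L * n ^ (3 + d * (13 * q + 3)) \<le> n ^ (Suc (Suc k) * C * L ^ Suc k)"
        by (simp only: D_def)
    qed
  qed
  then show ?thesis by (simp only: \<epsilon>_def)
qed

theorem theorem2:
  fixes d q n \<chi> :: nat
    and V :: "'a::linorder set" and E :: "'a set set"
  assumes "d \<ge> 1" and "q \<ge> 2"
    and "ordered_graph V E" and "card V = n"
    and "degenerate d V E" and "triangle_free V E"
    and "E \<noteq> {}"
    and "interval_chromatic_number V E = \<chi>"
  shows "ordered_ramsey_number V E q
           \<le> n ^ (21 * q ^ 2 * d * nat \<lceil>log 2 (real \<chi>)\<rceil> ^ (q - 1))"
proof -
  define L where "L = nat \<lceil>log 2 (real \<chi>)\<rceil>"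
  define N where "N = n ^ (21 * q ^ 2 * d * L ^ (q - 1))"
  have fin: "finite V" and EV: "E \<subseteq> [V]\<^bsup>2\<^esup>" using assms(3) by (auto simp: ordered_graph_def)
  obtain u v where uv: "u \<in> V" "v \<in> V" "u \<noteq> v" "{u, v} \<in> E"
  proof -
    obtain e where e: "e \<in> E" using assms(7) by blast
    then have "e \<subseteq> V" "card e = 2" using EV by (auto simp: nsets_def)
    then show thesis using e that by (auto simp: card_2_iff)
  qed
  have n: "2 \<le> n"
    using card_mono[OF fin, of "{u, v}"] uv assms(4) by simp
  obtain p where p: "\<forall>v\<in>V. p v < \<chi>" "\<forall>u\<in>V. \<forall>v\<in>V. {u, v} \<in> E \<longrightarrow> p u \<noteq> p v"
    using interval_chromatic_number_colouring[OF assms(3)] assms(8) by auto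
  \<comment> \<open>An edge forces two intervals, hence \<open>1 \<le> L\<close>.\<close>
  have "p u < \<chi>" "p v < \<chi>" "p u \<noteq> p v" using p uv by auto
  then have "2 \<le> \<chi>" by linarith
  note L = ceiling_log2_bounds[OF this L_def]
  have "ordered_arrows N V E q"
    unfolding ordered_arrows_def
  proof (rule ballI, rule ccontr)
    fix c assume c: "c \<in> [{..<N}]\<^bsup>2\<^esup> \<rightarrow> {..<q}"
      and "\<not> (\<exists>i<q. \<exists>f. ordered_copy f V E {..<N} ([{..<N}]\<^bsup>2\<^esup>) \<and>
        (\<forall>u\<in>V. \<forall>v\<in>V. {u, v} \<in> E \<longrightarrow> c {f u, f v} = i))"
    then have no_copy: "\<not> (\<exists>f. ordered_copy f V E {..<N} ([{..<N}]\<^bsup>2\<^esup>) \<and>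
        (\<forall>u\<in>V. \<forall>v\<in>V. {u, v} \<in> E \<longrightarrow> c {f u, f v} = i))" if "i < q" for i
      using that by blast
    define C where "C = 4 + d * (13 * q + 3)"
    have q: "Suc (q - 1) = q" using assms(2) by simp
    have pairs: "sparse_pairs c N q (n ^ (q * C * L ^ (q - 1))) (real n ^ (13 * q) / real n ^ (13 * q + 1))"
      using sparse_pairs_all_colours[OF assms(3,4) n assms(5,6,8) L no_copy C_def, of "q - 1"] assms(2)
      unfolding q by simp
    have "n ^ (q * C * L ^ (q - 1)) \<le> N"
      unfolding N_def
    proof (intro power_increasing mult_le_mono1)
      \<comment> \<open>The constant 21 is 13 + 8: the rest of \<open>C\<close> beyond
        \<open>13 * q * d\<close> is at most \<open>7 * d\<close>.\<close>
      have "4 + 3 * d \<le> 7 * d" using assms(1) by simp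
      also have "\<dots> \<le> 8 * q * d" using assms(2) by simp
      finally have "C \<le> 21 * q * d" by (simp add: C_def algebra_simps)
      then show "q * C \<le> 21 * q ^ 2 * d"
        using mult_le_mono2[of C "21 * q * d" q] by (simp add: power2_eq_square mult_ac)
    qed (use n in simp)
    then have "{..<N} \<subseteq> {..<N} \<and> n ^ (q * C * L ^ (q - 1)) * 1 \<le> card {..<N}" by simp
    then obtain X Y where XY: "X \<subseteq> {..<N}" "Y \<subseteq> {..<N}" "card X = 1" "card Y = 1" "\<forall>x\<in>X. \<forall>y\<in>Y. x < y"
      and e: "edges_between (\<lambda>x y. c {x, y} < q) X Y \<le> real n ^ (13 * q) / real n ^ (13 * q + 1) * 1\<^sup>2"
      using pairs[unfolded sparse_pairs_def, rule_format, of "{..<N}" 1] by auto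
    obtain x y where xy: "X = {x}" "Y = {y}" using XY(3,4) by (auto simp: card_1_singleton_iff)
    have "{x, y} \<in> [{..<N}]\<^bsup>2\<^esup>" using XY xy by auto
    then have "c {x, y} < q" using c by blast
    \<comment> \<open>The single edge between \<open>x\<close> and \<open>y\<close> has some colour
      below \<open>q\<close>, so the pair has density 1, not at most \<open>1 / n\<close>.\<close>
    then have "1 \<le> real n ^ (13 * q) / real n ^ (13 * q + 1)"
      using e xy by (simp add: edges_between_def)
    also have "\<dots> = 1 / real n" using n by simp
    finally show False using n by simp
  qed
  then show ?thesis
    unfolding ordered_ramsey_number_def N_def L_def by (rule Least_le)
qed

end
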